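(* Let $K\subset\mathbb{C}\setminus\{0\}$ be a polar compact set and let $U\subset\mathbb{C}$ be a bounded open set containing $K$. There exist a sequence $(\tau_n)_n$ in $(1,\infty)$ with $\tau_n\to 1$, a sequence $(\eta_n)_n$ of positive real numbers with $\eta_n\to 0$, and $N\in\mathbb{N}$, such that for every $\varphi\in A(\overline{U})$ and every $n\ge N$, there exists a polynomial $P_n$ of the form $P_n(z)=\sum_{k=\lfloor n/\tau_n\rfloor}^{n}a_kz^k$ (with $a_k\in\mathbb{C}$) such that $$\|P_n-\varphi\|_K\le\|\varphi\|_{\overline{U}}\,\eta_n^{\,n}.$$
   Context: $\mathbb{N}$ is the set of non-negative integers, and $\lfloor x\rfloor$ is the integer part of $x$. For a compact set $X\subset\mathbb{C}$, $A(X)$ is the space of complex functions continuous on $X$ and holomorphic in the interior of $X$, and $\|\cdot\|_X$ is the supremum norm on $X$. The (logarithmic) energy of a finite Borel measure $\mu$ with compact support in $\mathbb{C}$ is $I(\mu)=\iint\log|z-w|\,d\mu(w)\,d\mu(z)\in[-\infty,\infty)$. A compact set $K$ is polar if $I(\mu)=-\infty$ for every Borel probability measure $\mu$ supported on $K$ (equivalently, its logarithmic capacity is $0$). *)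

theory Defs
  imports "HOL-Complex_Analysis.Complex_Analysis" "HOL-Probability.Probability_Measure"
begin

(* Lebesgue integral of an extended-real function, as the difference of the integrals of its
   positive and negative parts (e2ennreal truncates negative values to 0).  It is meaningful
   when at least one of the two is finite, which is always the case below: the logarithmic
   kernel is bounded above on compact sets. *)
definition ext_integral :: "'a measure \<Rightarrow> ('a \<Rightarrow> ereal) \<Rightarrow> ereal" where
  "ext_integral M f =
     enn2ereal (\<integral>\<^sup>+ x. e2ennreal (f x) \<partial>M) - enn2ereal (\<integral>\<^sup>+ x. e2ennreal (- f x) \<partial>M)"

(* The diagonal must be treated separately, because ln 0 = 0 in the library. *)
definition log_kernel :: "complex \<Rightarrow> complex \<Rightarrow> ereal" where
  "log_kernel z w = (if z = w then -\<infinity> else ereal (ln (cmod (z - w))))"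

definition log_energy :: "complex measure \<Rightarrow> ereal" where
  "log_energy \<mu> = ext_integral \<mu> (\<lambda>z. ext_integral \<mu> (\<lambda>w. log_kernel z w))"

(* Intended for compact K; for closed K, being supported on K means that the complement
   of K is a null set. *)
definition polar :: "complex set \<Rightarrow> bool" where
  "polar K \<longleftrightarrow> (\<forall>\<mu> :: complex measure.
     sets \<mu> = sets borel \<and> prob_space \<mu> \<and> emeasure \<mu> (- K) = 0 \<longrightarrow> log_energy \<mu> = -\<infinity>)"

(* Values of f outside X are irrelevant. *)
definition A_space :: "complex set \<Rightarrow> (complex \<Rightarrow> complex) set" where
  "A_space X = {f. continuous_on X f \<and> f holomorphic_on interior X}"

(* The supremum over the empty set is unspecified for reals; as a norm it has to be 0. *)
definition sup_norm :: "complex set \<Rightarrow> (complex \<Rightarrow> complex) \<Rightarrow> real" where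
  "sup_norm X f = (if X = {} then 0 else (SUP z\<in>X. cmod (f z)))"

end

theory Submission
  imports Defs "HOL-Probability.Probability" "HOL-Real_Asymp.Real_Asymp"
begin

text \<open>Two facts about a polar compact set $K$ drive the proof.

  First, for every $\kappa > 0$ there is a monic polynomial with all its roots in $K$ that is at
  most $\kappa^d$ on $K$, where $d$ is its degree. Otherwise one could choose points of $K$ greedily, each far
  from the previous ones in the sense of a geometric mean, and a weak limit of their averages would be a
  probability measure on $K$ of finite energy.

  Second, the projections of $K$ to both axes contain no interval, so that $K$ is covered by
  finitely many rectangles of a grid whose lines avoid $K$. Their boundaries serve
  as integration contours in $U \setminus \{0\}$.

  For $m = o(n)$ and $s = n - m$ one interpolates $\varphi(z) / z^s$ at the $m$ roots of such polynomials
  by Hermite's contour formula, and multiplies the interpolant by $z^s$. Dividing and multiplying by $z^s$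
  costs a factor $A^n$ with $A$ independent of $\kappa$, while interpolation gains $(\kappa/\rho)^m$,
  which wins if $\kappa$ tends to $0$ fast enough in terms of $n / m$.\<close>

subsection \<open>Weak limits of averages of point masses\<close>

text \<open>Polarity enters as smallness for every \<open>\<kappa>\<close>. The contour is fixed
  before \<open>\<kappa>\<close>, and with it its length and its distances from K and from 0.
  Afterwards only the nodes change with the desired accuracy, so all losses keep a fixed exponential
  rate, which the gain can be made to beat.

  The contour has to surround K without surrounding 0, where the quotient of phi by z^s has a pole.
  Small boxes inside U minus 0 achieve this, each point of K lying inside exactly one of them. Since
  phi enters only through its values on the contour, the threshold for n does not depend on phi.

  In the energy argument the obstacle is the unbounded kernel: weak convergence tests bounded
  continuous functions only. The logarithm is therefore truncated at a level M, and n tends to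
  infinity before M does, which also makes the diagonal terms negligible.

  For a fixed \<open>\<epsilon>\<close> the target is tau = 1 + \<open>\<epsilon>\<close> and eta =
  \<open>\<epsilon>\<close>. The number m of nodes is close to n * \<open>\<epsilon>\<close> / (1 +
  \<open>\<epsilon>\<close>), because n minus this number is n / (1 + \<open>\<epsilon>\<close>).
  The sequences arise by letting \<open>\<epsilon>\<close> decrease slowly with n.\<close>

definition bump :: "real \<Rightarrow> real" where
  "bump t = max 0 (min 1 (1 / 2 - cos (pi * t)))"

lemma continuous_on_bump [continuous_intros]:
  fixes f :: "'a::t2_space \<Rightarrow> real"
  shows "continuous_on A f \<Longrightarrow> continuous_on A (\<lambda>x. bump (f x))"
  unfolding bump_def by (intro continuous_intros)

lemma bump_range: "0 \<le> bump t" "bump t \<le> 1"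
  by (auto simp: bump_def)

lemma bump_add_even: "bump (2 * of_int m + t) = bump t"
proof -
  have "cos (pi * (2 * of_int m + t)) = cos (2 * pi * of_int m + pi * t)"
    by (simp add: algebra_simps)
  also have "\<dots> = cos (pi * t)"
    by (simp only: cos_add cos_int_2pin sin_int_2pin mult_1 mult_zero_left diff_zero)
  finally show ?thesis by (simp add: bump_def)
qed

text \<open>This explains the formula for \<open>bump\<close>: 1/2 - cos(pi t) is at most 0 on
  [0, 1/3] and at least 1 on [2/3, 1], so clipping it to [0, 1] gives a continuous function of
  period 2 that reads off a ternary digit 0 or 2.\<close>

lemma bump_digit:
  assumes "d \<in> {0, 1}" "0 \<le> s" "s \<le> 1 / 3"
  shows "bump (2 * d / 3 + s) = d"
proof -
  have "cos (pi / 3) \<le> cos (pi * s)"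
    using assms pi_gt_zero by (intro cos_monotone_0_pi_le) auto
  then have *: "1 / 2 \<le> cos (pi * s)"
    by (simp add: cos_60)
  have "cos (pi * (2 / 3 + s)) = - cos (pi * (1 / 3 - s))"
    using cos_minus_pi[of "pi * (2 / 3 + s)"] cos_minus[of "pi * (2/3+s) - pi"]
    by (simp add: algebra_simps)
  moreover have "cos (pi / 3) \<le> cos (pi * (1 / 3 - s))"
    using assms pi_gt_zero by (intro cos_monotone_0_pi_le) (auto simp: field_simps)
  ultimately have **: "cos (pi * (2 / 3 + s)) \<le> - 1 / 2"
    by (simp add: cos_60)
  from assms(1) show ?thesis
    using * ** by (auto simp: bump_def)
qed

text \<open>The digits are read along the orbit of \<open>x\<close> under the doubling map; after n
  digits the remainder is exactly \<open>frac (2 ^ n * x) / 2 ^ n\<close>.\<close>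

lemma binary_expansion:
  fixes x :: real
  assumes "0 \<le> x" "x < 1"
  obtains b :: "nat \<Rightarrow> real" where "\<And>k. b k \<in> {0, 1}" "(\<lambda>k. b k / 2 ^ Suc k) sums x"
proof -
  define b where "b k = real_of_int (\<lfloor>2 * frac (2 ^ k * x)\<rfloor>)" for k
  have b01: "b k \<in> {0, 1}" for k
  proof -
    have "0 \<le> 2 * frac (2 ^ k * x)" "2 * frac (2 ^ k * x) < 2"
      using frac_lt_1[of "2 ^ k * x"] by auto
    then have "\<lfloor>2 * frac (2 ^ k * x)\<rfloor> \<in> {0, 1}"
      by (auto, linarith)
    then show ?thesis by (auto simp: b_def)
  qed
  have step: "frac (2 ^ Suc k * x) = 2 * frac (2 ^ k * x) - b k" for k
  proof -
    have "2 ^ Suc k * x = 2 * frac (2 ^ k * x) + of_int (2 * \<lfloor>2 ^ k * x\<rfloor>)"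
      by (simp add: frac_def)
    then have "frac (2 ^ Suc k * x) = frac (2 * frac (2 ^ k * x))"
      by (simp only: frac_def floor_add_int[symmetric] of_int_add)
    then show ?thesis by (simp add: b_def frac_def)
  qed
  have part: "(\<Sum>k<n. b k / 2 ^ Suc k) = x - frac (2 ^ n * x) / 2 ^ n" for n
  proof (induction n)
    case 0
    then show ?case using assms by (simp add: frac_eq)
  next
    case (Suc n)
    have "(\<Sum>k<Suc n. b k / 2 ^ Suc k) = x - frac (2 ^ n * x) / 2 ^ n + b n / 2 ^ Suc n"
      using Suc.IH by simp
    also have "\<dots> = x - frac (2 ^ Suc n * x) / 2 ^ Suc n"
      unfolding step by (simp add: field_simps)
    finally show ?case .
  qed
  have "(\<lambda>n. frac (2 ^ n * x) / 2 ^ n) \<longlonglongrightarrow> 0"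
  proof (rule tendsto_sandwich[of "\<lambda>_. 0"])
    show "(\<lambda>n. (1 / 2) ^ n :: real) \<longlonglongrightarrow> 0"
      by (rule LIMSEQ_realpow_zero) auto
    show "\<forall>\<^sub>F n in sequentially. frac (2 ^ n * x) / 2 ^ n \<le> (1 / 2) ^ n"
      by (simp add: power_one_over divide_simps less_imp_le[OF frac_lt_1])
  qed auto
  then have "(\<lambda>n. x - frac (2 ^ n * x) / 2 ^ n) \<longlonglongrightarrow> x - 0"
    by (intro tendsto_intros)
  then have "(\<lambda>k. b k / 2 ^ Suc k) sums x"
    unfolding sums_def part by simp
  with b01 show thesis using that by blast
qed

text \<open>After multiplication by \<open>3 ^ j\<close> the digits before position j, all equal to
  0 or 2, add up to an even integer, which the period of \<open>bump\<close> removes. Digit j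
  contributes \<open>2 * d j / 3\<close>, and the later ones contribute a number in
  [0, 1/3].\<close>

lemma bump_ternary:
  assumes d: "\<And>k. d k \<in> {0, 1 :: real}"
  shows "bump (3 ^ j * (\<Sum>k. 2 * d k / 3 ^ Suc k)) = d j"
proof -
  define f where "f k = 2 * d k / 3 ^ Suc k" for k
  have sm: "summable f"
  proof (rule summable_comparison_test)
    show "summable (\<lambda>k. (2 / 3) * (1 / 3 :: real) ^ k)"
      by (intro summable_mult summable_geometric) auto
    have "norm (f k) \<le> (2 / 3) * (1 / 3) ^ k" for k
      using d[of k] by (auto simp: f_def power_divide)
    then show "\<exists>N. \<forall>n\<ge>N. norm (f n) \<le> (2 / 3) * (1 / 3) ^ n" by blast
  qed
  have split: "suminf f = (\<Sum>k. f (k + Suc j)) + (\<Sum>k<Suc j. f k)"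
    by (rule suminf_split_initial_segment[OF sm])
  define s where "s = 3 ^ j * (\<Sum>k. f (k + Suc j))"
  have sm': "summable (\<lambda>k. f (k + Suc j))"
    using sm by (subst summable_iff_shift)
  have "0 \<le> (\<Sum>k. f (k + Suc j))"
  proof (rule suminf_nonneg[OF sm'])
    show "0 \<le> f (k + Suc j)" for k
      using d[of "k + Suc j"] by (auto simp: f_def)
  qed
  moreover have "(\<Sum>k. f (k + Suc j)) \<le> 1 / 3 ^ Suc j"
  proof -
    have "(\<lambda>k. (2 / 3 ^ Suc (Suc j)) * (1 / 3 :: real) ^ k) sums ((2 / 3 ^ Suc (Suc j)) * (1 / (1 - 1 / 3)))"
      by (intro sums_mult geometric_sums) auto
    then have g: "(\<lambda>k. (2 / 3 ^ Suc (Suc j)) * (1 / 3 :: real) ^ k) sums (1 / 3 ^ Suc j)"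
      by simp
    have "(\<Sum>k. f (k + Suc j)) \<le> (\<Sum>k. (2 / 3 ^ Suc (Suc j)) * (1 / 3 :: real) ^ k)"
    proof (rule suminf_le[OF _ sm' sums_summable[OF g]])
      fix k show "f (k + Suc j) \<le> (2 / 3 ^ Suc (Suc j)) * (1 / 3 :: real) ^ k"
        using d[of "k + Suc j"] by (auto simp: f_def power_add power_divide mult_ac)
    qed
    then show ?thesis using g by (simp add: sums_iff)
  qed
  ultimately have s: "0 \<le> s" "s \<le> 1 / 3"
    by (auto simp: s_def field_simps)
  have "\<exists>m::int. 3 ^ j * (\<Sum>k<j. f k) = 2 * of_int m"
  proof (induction j)
    case (Suc j)
    then obtain m :: int where "3 ^ j * (\<Sum>k<j. f k) = 2 * of_int m" by blast
    then have "3 ^ Suc j * (\<Sum>k<Suc j. f k) = 2 * (3 * of_int m + d j)"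
      by (simp add: f_def algebra_simps)
    then show ?case
      using d[of j] by (intro exI[of _ "3 * m + (if d j = 0 then 0 else 1)"]) auto
  qed auto
  then obtain m :: int where m: "3 ^ j * (\<Sum>k<j. f k) = 2 * of_int m" by blast
  have "3 ^ j * suminf f = 2 * of_int m + (2 * d j / 3 + s)"
    unfolding split using m by (simp add: s_def f_def algebra_simps)
  then show ?thesis
    unfolding f_def[symmetric] using bump_add_even bump_digit[OF d s] by metis
qed

text \<open>Schoenberg's space-filling curve: the even and the odd ternary digits of the
  parameter carry the binary digits of the real and of the imaginary part.\<close>
lemma space_filling_curve:
  obtains g :: "real \<Rightarrow> complex" where "continuous_on UNIV g"
    "\<And>z. Re z \<in> {0..<1} \<Longrightarrow> Im z \<in> {0..<1} \<Longrightarrow> \<exists>t\<in>{0..1}. g t = z"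
proof -
  define h where "h c t = (\<Sum>k. bump (3 ^ (2 * k + c) * t) / 2 ^ Suc k)" for c :: nat and t :: real
  have conth: "continuous_on UNIV (h c)" for c
  proof -
    have lim: "uniform_limit UNIV (\<lambda>n t. \<Sum>k<n. bump (3 ^ (2 * k + c) * t) / 2 ^ Suc k) (h c) sequentially"
      unfolding h_def
    proof (rule Weierstrass_m_test)
      show "norm (bump (3 ^ (2 * n + c) * t) / 2 ^ Suc n) \<le> (1 / 2) ^ n" for n t
        using bump_range[of "3 ^ (2 * n + c) * t"] by (simp add: power_divide divide_simps)
      show "summable (\<lambda>n. (1 / 2 :: real) ^ n)"
        by (rule summable_geometric) auto
    qed
    have cont: "continuous_on UNIV (\<lambda>t. \<Sum>k<n. bump (3 ^ (2 * k + c) * t) / 2 ^ Suc k)" for n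
      by (intro continuous_on_sum continuous_on_divide continuous_on_bump continuous_on_mult
          continuous_on_const continuous_on_id) simp
    show ?thesis
      by (rule uniform_limit_theorem[OF always_eventually lim]) (use cont in simp_all)
  qed
  show thesis
  proof
    show "continuous_on UNIV (\<lambda>t. Complex (h 0 t) (h 1 t))"
      by (intro continuous_on_Complex conth)
    fix z :: complex
    assume z: "Re z \<in> {0..<1}" "Im z \<in> {0..<1}"
    obtain b where b: "\<And>k. b k \<in> {0, 1 :: real}" "(\<lambda>k. b k / 2 ^ Suc k) sums Re z"
      using binary_expansion z by (metis atLeastLessThan_iff)
    obtain b' where b': "\<And>k. b' k \<in> {0, 1 :: real}" "(\<lambda>k. b' k / 2 ^ Suc k) sums Im z"
      using binary_expansion z by (metis atLeastLessThan_iff)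
    define d where "d k = (if even k then b (k div 2) else b' (k div 2))" for k
    have d: "d k \<in> {0, 1}" for k
      using b b' by (auto simp: d_def)
    define t where "t = (\<Sum>k. 2 * d k / 3 ^ Suc k)"
    have dig: "bump (3 ^ j * t) = d j" for j
      unfolding t_def by (rule bump_ternary[OF d])
    have "h 0 t = Re z" "h 1 t = Im z"
      unfolding h_def dig using b b' by (simp_all add: d_def sums_iff)
    moreover have "t \<in> {0..1}"
    proof -
      have g: "(\<lambda>k. (2 / 3) * (1 / 3 :: real) ^ k) sums ((2 / 3) * (1 / (1 - 1 / 3)))"
        by (intro sums_mult geometric_sums) auto
      have le: "2 * d k / 3 ^ Suc k \<le> (2 / 3) * (1 / 3 :: real) ^ k" and ge: "0 \<le> 2 * d k / 3 ^ Suc k" for k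
        using d[of k] by (auto simp: power_divide)
      have "norm (2 * d k / 3 ^ Suc k) \<le> (2 / 3) * (1 / 3) ^ k" for k
        using le[of k] ge[of k] by (simp only: real_norm_def abs_of_nonneg)
      then have sm: "summable (\<lambda>k. 2 * d k / 3 ^ Suc k)"
        by (intro summable_comparison_test[OF _ sums_summable[OF g]]) blast
      have "t \<le> 1"
        unfolding t_def using suminf_le[OF le sm sums_summable[OF g]] g by (simp add: sums_iff)
      moreover have "0 \<le> t"
        unfolding t_def using sm ge by (rule suminf_nonneg)
      ultimately show ?thesis by simp
    qed
    ultimately show "\<exists>t\<in>{0..1}. Complex (h 0 t) (h 1 t) = z"
      by (intro bexI[of _ t]) auto
  qed
qed

lemma continuous_preimage_bounded_complex:
  fixes K :: "complex set"
  assumes "bounded K"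
  obtains g :: "real \<Rightarrow> complex" where "continuous_on UNIV g"
    "\<And>z. z \<in> K \<Longrightarrow> \<exists>t\<in>{0..1}. g t = z"
proof -
  \<comment> \<open>The strict bound matters: after rescaling, the coordinates have to lie in the
    half-open unit interval.\<close>
  obtain R where R: "R > 0" "\<And>z. z \<in> K \<Longrightarrow> norm z < R"
    using assms bounded_pos_less by metis
  obtain g :: "real \<Rightarrow> complex" where g: "continuous_on UNIV g"
    "\<And>z. Re z \<in> {0..<1} \<Longrightarrow> Im z \<in> {0..<1} \<Longrightarrow> \<exists>t\<in>{0..1}. g t = z"
    using space_filling_curve by blast
  show thesis
  proof
    show "continuous_on UNIV (\<lambda>t. of_real (2 * R) * (g t - Complex (1 / 2) (1 / 2)))"
      by (intro continuous_intros g)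
    fix z assume "z \<in> K"
    then have "\<bar>Re z\<bar> < R" "\<bar>Im z\<bar> < R"
      using R abs_Re_le_cmod[of z] abs_Im_le_cmod[of z] by fastforce+
    define w where "w = Complex (Re z / (2 * R) + 1 / 2) (Im z / (2 * R) + 1 / 2)"
    have "Re w \<in> {0..<1}" "Im w \<in> {0..<1}"
      using R \<open>\<bar>Re z\<bar> < R\<close> \<open>\<bar>Im z\<bar> < R\<close> by (auto simp: w_def field_simps)
    then obtain t where "t \<in> {0..1}" "g t = w" using g(2) by blast
    moreover have "of_real (2 * R) * (w - Complex (1 / 2) (1 / 2)) = z"
      using R by (simp add: w_def complex_eq_iff)
    ultimately show "\<exists>t\<in>{0..1}. of_real (2 * R) * (g t - Complex (1 / 2) (1 / 2)) = z"
      by blast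
  qed
qed

text \<open>Helly's selection theorem is available on the real line only; a space-filling curve
  transports it to the plane.\<close>
lemma weak_limit_of_averages:
  fixes a :: "nat \<Rightarrow> complex"
  assumes K: "compact K" and a: "\<And>n. a n \<in> K"
  obtains r :: "nat \<Rightarrow> nat" and \<mu> :: "complex measure"
  where "strict_mono r" "prob_space \<mu>" "sets \<mu> = sets borel" "emeasure \<mu> (- K) = 0"
    "\<And>h. continuous_on UNIV h \<Longrightarrow> bounded (range h) \<Longrightarrow>
       (\<lambda>n. (\<Sum>i\<le>r n. h (a i)) / Suc (r n)) \<longlonglongrightarrow> integral\<^sup>L \<mu> h"
proof -
  obtain g :: "real \<Rightarrow> complex" where g: "continuous_on UNIV g"
    "\<And>z. z \<in> K \<Longrightarrow> \<exists>t\<in>{0..1}. g t = z"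
    using continuous_preimage_bounded_complex compact_imp_bounded[OF K] by metis
  then have "\<forall>i. \<exists>s. s \<in> {0..1} \<and> g s = a i"
    using a by blast
  then obtain t where "\<forall>i. t i \<in> {0..1} \<and> g (t i) = a i"
    by (rule choice[THEN exE])
  then have t: "\<And>i. t i \<in> {0..1}" "\<And>i. g (t i) = a i"
    by auto
  define M where "M n = distr (measure_pmf (pmf_of_set {..n})) borel t" for n :: nat
  have [simp]: "sets (M n) = sets borel" "space (M n) = UNIV" for n
    by (auto simp: M_def)
  have pM: "prob_space (M n)" for n
    unfolding M_def by (rule measure_pmf.prob_space_distr) simp
  have int: "integral\<^sup>L (M n) f = (\<Sum>i\<le>n. f (t i)) / Suc n" if "continuous_on UNIV f" for f :: "real \<Rightarrow> real" and n
  proof -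
    have [measurable]: "f \<in> borel_measurable borel"
      using that by (rule borel_measurable_continuous_onI)
    show ?thesis unfolding M_def
      by (subst integral_distr) (auto simp: integral_pmf_of_set)
  qed
  have rd: "real_distribution (M n)" for n
    using pM by (simp add: real_distribution_def real_distribution_axioms_def)
  \<comment> \<open>Tightness is phrased with half-open intervals, so the left end is placed below 0
    to keep the parameter 0 inside.\<close>
  have M1: "measure (M n) {-1<..1} = 1" for n
  proof -
    have "t -` {-1<..1} = UNIV"
    proof -
      have "-1 < t i \<and> t i \<le> 1" for i using t(1)[of i] by auto
      then show ?thesis by auto
    qed
    moreover have "measure (M n) {-1<..1} = measure (measure_pmf (pmf_of_set {..n})) (t -` {-1<..1})"
      unfolding M_def by (subst measure_distr) auto
    ultimately show ?thesis by simp
  qed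
  have "tight M"
    unfolding tight_def
  proof (intro conjI allI impI rd)
    fix e :: real
    assume "e > 0"
    then show "\<exists>a b. a < b \<and> (\<forall>n. 1 - e < measure (M n) {a<..b})"
      using M1 by (intro exI[of _ "-1"] exI[of _ 1]) simp
  qed
  then obtain r \<nu> where r: "strict_mono r" and \<nu>: "real_distribution \<nu>" "weak_conv_m (M \<circ> id \<circ> r) \<nu>"
    using tight_imp_convergent_subsubsequence[of M id] strict_mono_id by blast
  interpret \<nu>: real_distribution \<nu> by fact
  have [measurable]: "g \<in> borel_measurable borel"
    using g(1) by (rule borel_measurable_continuous_onI)
  then have g\<nu> [measurable]: "g \<in> measurable \<nu> borel"
    by (simp cong: measurable_cong_sets)
  define \<mu> where "\<mu> = distr \<nu> borel g"
  have [simp]: "sets \<mu> = sets borel" "space \<mu> = UNIV" by (auto simp: \<mu>_def)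
  interpret \<mu>: prob_space \<mu>
    unfolding \<mu>_def by (rule \<nu>.prob_space_distr) simp
  have conv: "(\<lambda>n. (\<Sum>i\<le>r n. h (a i)) / Suc (r n)) \<longlonglongrightarrow> integral\<^sup>L \<mu> h"
    if h: "continuous_on UNIV h" "bounded (range h)" for h :: "complex \<Rightarrow> real"
  proof -
    obtain B where B: "\<And>z. \<bar>h z\<bar> \<le> B"
      using h(2) by (auto simp: bounded_iff)
    have hg: "continuous_on UNIV (\<lambda>x. h (g x))"
      using h(1) g(1) by (intro continuous_on_compose2[OF h(1) g(1)]) auto
    have [measurable]: "h \<in> borel_measurable borel"
      using h(1) by (rule borel_measurable_continuous_onI)
    have "(\<lambda>n. integral\<^sup>L ((M \<circ> id \<circ> r) n) (\<lambda>x. h (g x))) \<longlonglongrightarrow> integral\<^sup>L \<nu> (\<lambda>x. h (g x))"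
    proof (rule weak_conv_imp_integral_bdd_continuous_conv[where B = B])
      show "isCont (\<lambda>x. h (g x)) x" for x
        using hg by (simp add: continuous_on_eq_continuous_at)
    qed (use rd \<nu> B in \<open>auto simp: o_def\<close>)
    moreover have "integral\<^sup>L \<mu> h = integral\<^sup>L \<nu> (\<lambda>x. h (g x))"
      unfolding \<mu>_def by (rule integral_distr) auto
    ultimately show ?thesis by (simp add: int[OF hg] t)
  qed
  \<comment> \<open>The truncated distance to K is a bounded continuous test function that detects
    mass off K: it vanishes at all \<open>a i\<close>, hence its integral under the limit is 0, and
    its zero set is K because K is closed.\<close>
  define k where "k z = min 1 (infdist z K)" for z
  have "K \<noteq> {}" using a by blast
  have k: "continuous_on UNIV k" "\<bar>k z\<bar> \<le> 1" "0 \<le> k z" for z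
    unfolding k_def using infdist_nonneg[of z K] by (auto intro!: continuous_intros)
  have [measurable]: "k \<in> borel_measurable borel"
    using k(1) by (rule borel_measurable_continuous_onI)
  have kb: "bounded (range k)"
    using k(2) by (auto simp: bounded_iff)
  have "integral\<^sup>L \<mu> k = 0"
  proof -
    have "k (a i) = 0" for i using a by (simp add: k_def)
    then have "(\<lambda>n. 0) \<longlonglongrightarrow> integral\<^sup>L \<mu> k"
      using conv[OF k(1) kb] by simp
    then show ?thesis by (simp add: LIMSEQ_const_iff)
  qed
  moreover have "integrable \<mu> k"
    using k(2) by (intro \<mu>.integrable_const_bound[where B = 1]) (simp_all cong: measurable_cong_sets)
  ultimately have "AE z in \<mu>. k z = 0"
    using k integral_nonneg_eq_0_iff_AE[of \<mu> k] by auto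
  then have "AE z in \<mu>. z \<in> K"
    using in_closed_iff_infdist_zero[OF compact_imp_closed[OF K] \<open>K \<noteq> {}\<close>]
    by (elim eventually_mono) (auto simp: k_def min_def split: if_splits)
  then have "emeasure \<mu> (- K) = 0"
    using AE_iff_measurable[of "- K" \<mu> "\<lambda>z. z \<in> K"] compact_imp_closed[OF K] by auto
  then show thesis
    by (intro that[OF r \<mu>.prob_space_axioms _ _ conv]) auto
qed

subsection \<open>Small products on polar sets\<close>

text \<open>For M \<ge> 0 this is - ln t cut off to the interval [0, M]. Its value at t = 0 is M, although the
  library sets ln 0 = 0.\<close>
definition trunc_log :: "real \<Rightarrow> real \<Rightarrow> real" where
  "trunc_log M t = - ln (max (exp (- M)) (min 1 t))"

lemma max_exp_pos: "0 < max (exp x) (y :: real)"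
  by (simp add: less_max_iff_disj)

lemma trunc_log_nonneg: "0 \<le> M \<Longrightarrow> 0 \<le> trunc_log M t"
  using max_exp_pos[of "- M" "min 1 t"] by (simp add: trunc_log_def)

lemma trunc_log_le: "trunc_log M t \<le> M"
proof -
  have "ln (exp (- M)) \<le> ln (max (exp (- M)) (min 1 t))"
    by (subst ln_le_cancel_iff) (auto simp: less_max_iff_disj)
  then show ?thesis by (simp add: trunc_log_def)
qed

lemma trunc_log_zero: "0 \<le> M \<Longrightarrow> trunc_log M 0 = M"
  by (simp add: trunc_log_def max_def)

lemma trunc_log_le_neg_ln:
  assumes "t > 0" shows "trunc_log M t \<le> max 0 (- ln t)"
proof -
  have "ln (min 1 t) \<le> ln (max (exp (- M)) (min 1 t))"
    using assms by (subst ln_le_cancel_iff) (auto simp: less_max_iff_disj)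
  then show ?thesis
    by (auto simp: trunc_log_def min_def split: if_splits)
qed

lemma trunc_log_eq_neg_ln:
  assumes "t > 0" "- ln t \<le> M" "0 \<le> M" shows "trunc_log M t = max 0 (- ln t)"
proof -
  have "exp (- M) \<le> exp (ln t)"
    using assms by (subst exp_le_cancel_iff) auto
  then have "exp (- M) \<le> t" using assms by simp
  then have "max (exp (- M)) (min 1 t) = min 1 t"
    using assms by (intro max_absorb2) auto
  then show ?thesis
    using assms by (auto simp: trunc_log_def min_def)
qed

text \<open>Clipping is 1-Lipschitz, and the logarithm has slope at most exp M to the right of exp
  (- M).\<close>

lemma trunc_log_lipschitz: "\<bar>trunc_log M s - trunc_log M t\<bar> \<le> exp M * \<bar>s - t\<bar>"
proof -
  define u where "u x = max (exp (- M)) (min 1 x)" for x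
  have pos: "exp (- M) \<le> u x" "0 < u x" for x
    by (auto simp: u_def less_max_iff_disj)
  have *: "ln (u x) - ln (u y) \<le> exp M * \<bar>x - y\<bar>" for x y
  proof -
    have "ln (u x) - ln (u y) \<le> (u x - u y) / u y"
      using pos by (intro ln_diff_le)
    also have "\<dots> \<le> \<bar>x - y\<bar> / exp (- M)"
      by (rule frac_le) (use pos in \<open>auto simp: u_def\<close>)
    finally show ?thesis by (simp add: exp_minus field_simps)
  qed
  from *[of s t] *[of t s] show ?thesis
    by (simp add: trunc_log_def u_def abs_minus_commute abs_le_iff)
qed

lemma continuous_on_trunc_log [continuous_intros]:
  fixes f :: "'a::t2_space \<Rightarrow> real"
  shows "continuous_on A f \<Longrightarrow> continuous_on A (\<lambda>x. trunc_log M (f x))"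
  unfolding trunc_log_def
  by (intro continuous_intros ballI less_imp_neq[symmetric] max_exp_pos)

text \<open>The limit inherits the Lipschitz constant, so convergence on a finite net of K controls
  all of K. Uniformity is what the energy estimate needs: there the n-th potential is evaluated at
  points whose number grows with n.\<close>

lemma uniform_limit_equi_lipschitz:
  fixes f :: "nat \<Rightarrow> 'a::metric_space \<Rightarrow> real"
  assumes K: "compact K" and L: "L \<ge> 0"
    and lip: "\<And>n x y. \<bar>f n x - f n y\<bar> \<le> L * dist x y"
    and lim: "\<And>x. (\<lambda>n. f n x) \<longlonglongrightarrow> g x"
  shows "uniform_limit K f g sequentially"
proof (rule uniform_limitI)
  fix e :: real assume e: "e > 0"
  have lipg: "\<bar>g x - g y\<bar> \<le> L * dist x y" for x y
    by (rule LIMSEQ_le_const2[of "\<lambda>n. \<bar>f n x - f n y\<bar>"]) (auto intro!: tendsto_intros lim lip)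
  \<comment> \<open>The summand 1 in \<open>L + 1\<close> keeps the denominator positive when L =
    0.\<close>
  define r where "r = e / (3 * (L + 1))"
  have r: "r > 0" using e L by (simp add: r_def)
  have Lr: "L * r < e / 3"
    using e L by (simp add: r_def field_simps)
  obtain T where T: "finite T" "T \<subseteq> K" "K \<subseteq> (\<Union>x\<in>T. ball x r)"
    using K r by (auto elim!: compactE_image[of K K "\<lambda>x. ball x r"])
  have "\<forall>\<^sub>F n in sequentially. \<forall>x\<in>T. dist (f n x) (g x) < e / 3"
    using T(1) e by (intro eventually_ball_finite ballI tendstoD[OF lim]) auto
  then show "\<forall>\<^sub>F n in sequentially. \<forall>x\<in>K. dist (f n x) (g x) < e"
  proof (rule eventually_mono, intro ballI)
    fix n x
    assume n: "\<forall>x\<in>T. dist (f n x) (g x) < e / 3" and "x \<in> K"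
    then obtain y where y: "y \<in> T" "dist y x < r" using T by auto
    have "L * dist x y \<le> L * r"
      using y L by (intro mult_left_mono) (auto simp: dist_commute)
    then show "dist (f n x) (g x) < e"
      using n[rule_format, OF y(1)] lip[of n x y] lipg[of x y] Lr
        dist_triangle[of "f n x" "g x" "f n y"] dist_triangle[of "f n y" "g x" "g y"]
      by (simp only: dist_real_def abs_minus_commute[of "g y" "g x"])
  qed
qed

text \<open>By symmetry each row below the diagonal counts twice, which gives 2 * c * (1 + ... + n)
  = c * n * (n + 1). The diagonal contributes only linearly in n and disappears after division by
  the square of n + 1.\<close>

lemma sum_symmetric_le:
  fixes k :: "nat \<Rightarrow> nat \<Rightarrow> real"
  assumes sym: "\<And>i j. k i j = k j i" and diag: "\<And>i. k i i \<le> M"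
    and off: "\<And>n. (\<Sum>i<n. k n i) \<le> c * n"
  shows "(\<Sum>i\<le>n. \<Sum>j\<le>n. k i j) \<le> c * (real n * Suc n) + M * Suc n"
proof (induction n)
  case 0
  then show ?case using diag by simp
next
  case (Suc n)
  have "(\<Sum>i\<le>n. k i (Suc n)) = (\<Sum>i\<le>n. k (Suc n) i)"
    by (intro sum.cong sym refl)
  then have "(\<Sum>i\<le>Suc n. \<Sum>j\<le>Suc n. k i j) = (\<Sum>i\<le>n. \<Sum>j\<le>n. k i j) + 2 * (\<Sum>j<Suc n. k (Suc n) j) + k (Suc n) (Suc n)"
    by (simp add: sum.distrib lessThan_Suc_atMost)
  also have "\<dots> \<le> (c * (real n * Suc n) + M * Suc n) + 2 * (c * Suc n) + M"
    using Suc diag[of "Suc n"] off[of "Suc n"] by linarith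
  also have "\<dots> = c * (real (Suc n) * Suc (Suc n)) + M * Suc (Suc n)"
    by (simp add: algebra_simps)
  finally show ?case .
qed

section \<open>Finite logarithmic energy from bounds on the truncated energies\<close>

lemma e2ennreal_uminus_ext_integral_le:
  "e2ennreal (- ext_integral M f) \<le> (\<integral>\<^sup>+ x. e2ennreal (- f x) \<partial>M)"
proof -
  have "- (enn2ereal a - enn2ereal b) \<le> enn2ereal b" for a b :: ennreal
    by (cases "enn2ereal a"; cases "enn2ereal b") (use enn2ereal_nonneg[of a] in auto)
  then have "e2ennreal (- ext_integral M f) \<le> e2ennreal (enn2ereal (\<integral>\<^sup>+ x. e2ennreal (- f x) \<partial>M))"
    unfolding ext_integral_def by (intro e2ennreal_mono)
  then show ?thesis by simp
qed

text \<open>A finite negative part suffices: whether the positive part is finite or infinite,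
  subtracting a finite number from a nonnegative one never gives
  \<open>- \<infinity>\<close>.\<close>

lemma ext_integral_neq_minus_infinity:
  assumes "(\<integral>\<^sup>+ x. e2ennreal (- f x) \<partial>M) < \<infinity>"
  shows "ext_integral M f \<noteq> - \<infinity>"
proof -
  obtain c where "c \<ge> 0" "(\<integral>\<^sup>+ x. e2ennreal (- f x) \<partial>M) = ennreal c"
    using assms by (cases "\<integral>\<^sup>+ x. e2ennreal (- f x) \<partial>M") auto
  then show ?thesis
    unfolding ext_integral_def
    using enn2ereal_nonneg[of "\<integral>\<^sup>+ x. e2ennreal (f x) \<partial>M"]
    by (cases "enn2ereal (\<integral>\<^sup>+ x. e2ennreal (f x) \<partial>M)") (auto simp: enn2ereal_ennreal)
qed

text \<open>Off the diagonal a single M beyond the value of - ln is enough. On the diagonal the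
  truncations equal M, so their supremum is \<open>top\<close>, as the kernel value
  \<open>- \<infinity>\<close> requires.\<close>

lemma log_kernel_le_SUP_trunc_log:
  "e2ennreal (- log_kernel z w) \<le> (SUP M::nat. ennreal (trunc_log (real M) (cmod (z - w))))"
proof (cases "z = w")
  case True
  have "(SUP M::nat. ennreal (trunc_log (real M) (cmod (z - w)))) = top"
    using True by (simp only: trunc_log_zero diff_self norm_zero of_nat_0_le_iff
        ennreal_of_nat_eq_real_of_nat[symmetric] ennreal_SUP_of_nat_eq_top)
  then show ?thesis by (simp only: top_greatest)
next
  case False
  obtain M :: nat where M: "- ln (cmod (z - w)) \<le> real M"
    using real_arch_simple by blast
  have "e2ennreal (- log_kernel z w) = ennreal (- ln (cmod (z - w)))"
    using False by (simp add: log_kernel_def ennreal.abs_eq e2ennreal_ereal)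
  also have "\<dots> \<le> ennreal (trunc_log (real M) (cmod (z - w)))"
    using False M by (subst trunc_log_eq_neg_ln) (auto intro!: ennreal_leI)
  also have "\<dots> \<le> (SUP M::nat. ennreal (trunc_log (real M) (cmod (z - w))))"
    by (rule SUP_upper) simp
  finally show ?thesis .
qed

lemma trunc_log_mono:
  assumes "M \<le> N" shows "trunc_log M t \<le> trunc_log N t"
proof -
  have "max (exp (- N)) (min 1 t) \<le> max (exp (- M)) (min 1 t)"
    using assms by (intro max.mono) auto
  then have "ln (max (exp (- N)) (min 1 t)) \<le> ln (max (exp (- M)) (min 1 t))"
    by (rule ln_mono) (rule max_exp_pos)
  then show ?thesis by (simp only: trunc_log_def neg_le_iff_le)
qed

text \<open>The truncations increase with M, so monotone convergence, applied to the inner and then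
  to the outer integral, bounds the negative part of the energy by the supremum of the truncated
  energies.\<close>

lemma log_energy_neq_minus_infinity:
  fixes \<mu> :: "complex measure"
  assumes "prob_space \<mu>" and [measurable_cong]: "sets \<mu> = sets borel"
    and bd: "\<And>M::nat. (\<integral>z. \<integral>w. trunc_log M (cmod (z - w)) \<partial>\<mu> \<partial>\<mu>) \<le> C"
  shows "log_energy \<mu> \<noteq> - \<infinity>"
proof -
  interpret prob_space \<mu> by fact
  define k where "k M z w = trunc_log (real M) (cmod (z - w))" for M :: nat and z w :: complex
  have k: "0 \<le> k M z w" "k M z w \<le> M" for M z w
    by (auto simp: k_def trunc_log_nonneg trunc_log_le)
  have "(\<lambda>p. k M (fst p) (snd p)) \<in> borel_measurable (borel :: (complex \<times> complex) measure)" for M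
    unfolding k_def by (intro borel_measurable_continuous_onI continuous_intros)
  then have meas2 [measurable]: "(\<lambda>p. k M (fst p) (snd p)) \<in> borel_measurable (borel \<Otimes>\<^sub>M borel)" for M
    by (simp add: borel_prod)
  have meas [measurable]: "k M z \<in> borel_measurable borel" for M z
    unfolding k_def by (intro borel_measurable_continuous_onI continuous_intros)
  have ki: "integrable \<mu> (k M z)" for M z
    using k by (intro integrable_const_bound[where B = M]) auto
  have "(\<lambda>z. \<integral>w. k M z w \<partial>\<mu>) \<in> borel_measurable \<mu>" for M
    using meas2[of M] by (intro borel_measurable_lebesgue_integral) (simp add: case_prod_unfold cong: measurable_cong_sets)
  moreover have kI: "0 \<le> (\<integral>w. k M z w \<partial>\<mu>)" "(\<integral>w. k M z w \<partial>\<mu>) \<le> M" for M z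
    using k by (auto intro!: integral_nonneg_AE integral_le_const ki)
  ultimately have kII: "integrable \<mu> (\<lambda>z. \<integral>w. k M z w \<partial>\<mu>)" for M
    by (intro integrable_const_bound[where B = M]) auto
  have fin: "(\<integral>\<^sup>+z. \<integral>\<^sup>+w. ennreal (k M z w) \<partial>\<mu> \<partial>\<mu>) \<le> ennreal C" for M
  proof -
    have "(\<integral>\<^sup>+z. \<integral>\<^sup>+w. ennreal (k M z w) \<partial>\<mu> \<partial>\<mu>) = (\<integral>\<^sup>+z. ennreal (\<integral>w. k M z w \<partial>\<mu>) \<partial>\<mu>)"
      using k by (intro nn_integral_cong nn_integral_eq_integral ki) auto
    also have "\<dots> = ennreal (\<integral>z. \<integral>w. k M z w \<partial>\<mu> \<partial>\<mu>)"
      using kI by (intro nn_integral_eq_integral kII) auto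
    also have "\<dots> \<le> ennreal C"
      using bd[of M] by (intro ennreal_leI) (simp add: k_def)
    finally show ?thesis .
  qed
  have inc: "incseq (\<lambda>M w. ennreal (k M z w))" for z
    by (auto simp: incseq_def le_fun_def k_def intro!: ennreal_leI trunc_log_mono)
  have meas3 [measurable]: "(\<lambda>z. \<integral>\<^sup>+w. ennreal (k M z w) \<partial>\<mu>) \<in> borel_measurable \<mu>" for M
    using meas2[of M] by (intro borel_measurable_nn_integral) (simp add: case_prod_unfold cong: measurable_cong_sets)
  have "(\<integral>\<^sup>+ z. e2ennreal (- ext_integral \<mu> (log_kernel z)) \<partial>\<mu>)
      \<le> (\<integral>\<^sup>+ z. \<integral>\<^sup>+ w. (SUP M. ennreal (k M z w)) \<partial>\<mu> \<partial>\<mu>)"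
    using log_kernel_le_SUP_trunc_log
    by (intro nn_integral_mono order.trans[OF e2ennreal_uminus_ext_integral_le]) (simp add: k_def)
  also have "\<dots> = (\<integral>\<^sup>+ z. (SUP M. \<integral>\<^sup>+ w. ennreal (k M z w) \<partial>\<mu>) \<partial>\<mu>)"
    by (intro nn_integral_cong nn_integral_monotone_convergence_SUP inc) auto
  also have "\<dots> = (SUP M. \<integral>\<^sup>+ z. \<integral>\<^sup>+ w. ennreal (k M z w) \<partial>\<mu> \<partial>\<mu>)"
    using inc by (intro nn_integral_monotone_convergence_SUP)
      (auto simp: incseq_def le_fun_def intro!: nn_integral_mono)
  also have "\<dots> \<le> ennreal C"
    using fin by (intro SUP_least)
  finally show ?thesis
    unfolding log_energy_def by (intro ext_integral_neq_minus_infinity) (auto simp: le_less_trans)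
qed

text \<open>The hypothesis bounds the discrete energies of the first n points off the diagonal. A
  weak limit of their averages inherits such a bound for every truncated kernel, with a constant
  independent of M, and hence has finite energy.\<close>

lemma not_polarI:
  fixes a :: "nat \<Rightarrow> complex" and c :: real
  assumes K: "compact K" and aK: "\<And>n. a n \<in> K" and ne: "\<And>n i. i < n \<Longrightarrow> a n \<noteq> a i"
    and c: "\<And>n. (\<Sum>i<n. max 0 (- ln (cmod (a n - a i)))) \<le> c * n"
  shows "\<not> polar K"
proof -
  obtain r :: "nat \<Rightarrow> nat" and \<mu> :: "complex measure"
  where r: "strict_mono r" and \<mu>: "prob_space \<mu>" "sets \<mu> = sets borel" "emeasure \<mu> (- K) = 0"
    and conv: "\<And>h. continuous_on UNIV h \<Longrightarrow> bounded (range h) \<Longrightarrow>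
       (\<lambda>n. (\<Sum>i\<le>r n. h (a i)) / Suc (r n)) \<longlonglongrightarrow> integral\<^sup>L \<mu> h"
    by (rule weak_limit_of_averages[where a = a, OF K aK]) (rule that, assumption+)
  interpret prob_space \<mu> by fact
  have [measurable_cong]: "sets \<mu> = sets borel" by fact
  have "(\<integral>z. \<integral>w. trunc_log M (cmod (z - w)) \<partial>\<mu> \<partial>\<mu>) \<le> c + 1" for M :: nat
  proof -
    define k where "k z w = trunc_log (real M) (cmod (z - w))" for z w :: complex
    have k: "0 \<le> k z w" "k z w \<le> M" for z w
      by (auto simp: k_def trunc_log_nonneg trunc_log_le)
    have contk: "continuous_on UNIV (k z)" for z
      unfolding k_def by (intro continuous_intros)
    have [measurable]: "k z \<in> borel_measurable borel" for z
      using contk by (rule borel_measurable_continuous_onI)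
    have ki: "integrable \<mu> (k z)" for z
      using k by (intro integrable_const_bound[where B = M]) auto
    \<comment> \<open>The double integral is treated one variable at a time: \<open>f n\<close> is
      the truncated potential of the n-th average and \<open>g\<close> that of the limit measure. As
      \<open>g\<close> is continuous and bounded, it is itself a test function for weak
      convergence.\<close>
    define f where "f n z = (\<Sum>j\<le>r n. k z (a j)) / Suc (r n)" for n z
    define g where "g z = integral\<^sup>L \<mu> (k z)" for z
    have lipk: "\<bar>k x w - k y w\<bar> \<le> exp M * dist x y" for x y w
    proof -
      have "\<bar>k x w - k y w\<bar> \<le> exp M * \<bar>cmod (x - w) - cmod (y - w)\<bar>"
        unfolding k_def by (rule trunc_log_lipschitz)
      also have "\<dots> \<le> exp M * dist x y"
        using norm_triangle_ineq3[of "x - w" "y - w"] by (simp add: dist_norm)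
      finally show ?thesis .
    qed
    have lim: "(\<lambda>n. f n z) \<longlonglongrightarrow> g z" for z
      unfolding f_def g_def using k by (intro conv contk) (auto simp: bounded_iff intro!: exI[of _ "real M"])
    have lipf: "\<bar>f n x - f n y\<bar> \<le> exp M * dist x y" for n x y
    proof -
      have "\<bar>f n x - f n y\<bar> = \<bar>\<Sum>j\<le>r n. k x (a j) - k y (a j)\<bar> / Suc (r n)"
        by (simp add: f_def sum_subtractf diff_divide_distrib[symmetric] abs_divide)
      also have "\<dots> \<le> (\<Sum>j\<le>r n. exp M * dist x y) / Suc (r n)"
        by (intro divide_right_mono order.trans[OF sum_abs] sum_mono lipk) auto
      also have "\<dots> = exp M * dist x y" by simp
      finally show ?thesis .
    qed
    have lipg: "\<bar>g x - g y\<bar> \<le> exp M * dist x y" for x y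
      by (rule LIMSEQ_le_const2[of "\<lambda>n. \<bar>f n x - f n y\<bar>"]) (auto intro!: tendsto_intros lim lipf)
    have contg: "continuous_on UNIV g"
    proof (rule lipschitz_on_continuous_on)
      show "(exp M)-lipschitz_on UNIV g"
        using lipg by (intro lipschitz_onI) (auto simp: dist_real_def)
    qed
    have g: "\<bar>g z\<bar> \<le> M" for z
    proof -
      have "0 \<le> g z" "g z \<le> M"
        unfolding g_def using k by (auto intro!: integral_nonneg_AE integral_le_const ki)
      then show ?thesis by simp
    qed
    have "\<forall>\<^sub>F n in sequentially. \<forall>x\<in>K. dist (f n x) (g x) < 1"
      using uniform_limit_equi_lipschitz[OF K _ lipf lim] by (auto simp: uniform_limit_iff)
    \<comment> \<open>The 1 is the uniform error of \<open>f n\<close> against \<open>g\<close>, and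
      the last term is the contribution of the diagonal. Any bound independent of M in the limit
      serves the purpose, so an error of 1 is affordable.\<close>
    then have ev: "\<forall>\<^sub>F n in sequentially. (\<Sum>i\<le>r n. g (a i)) / Suc (r n) \<le> c + 1 + M / Suc (r n)"
    proof eventually_elim
      case (elim n)
      have "(\<Sum>i\<le>r n. g (a i)) \<le> (\<Sum>i\<le>r n. f n (a i) + 1)"
      proof (intro sum_mono)
        fix i
        have "dist (f n (a i)) (g (a i)) < 1" using elim aK by blast
        then show "g (a i) \<le> f n (a i) + 1" by (simp add: dist_real_def abs_less_iff)
      qed
      also have "\<dots> = (\<Sum>i\<le>r n. \<Sum>j\<le>r n. k (a i) (a j)) / Suc (r n) + Suc (r n)"
        by (simp add: sum.distrib f_def sum_divide_distrib)
      finally have 1: "(\<Sum>i\<le>r n. g (a i)) \<le> (\<Sum>i\<le>r n. \<Sum>j\<le>r n. k (a i) (a j)) / Suc (r n) + Suc (r n)" .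
      have "(\<Sum>i\<le>r n. \<Sum>j\<le>r n. k (a i) (a j)) \<le> c * (real (r n) * Suc (r n)) + M * Suc (r n)"
      proof (rule sum_symmetric_le)
        show "k (a i) (a j) = k (a j) (a i)" for i j
          by (simp add: k_def norm_minus_commute)
        show "(\<Sum>i<n. k (a n) (a i)) \<le> c * n" for n
          unfolding k_def using ne
          by (intro order.trans[OF sum_mono c[of n]] trunc_log_le_neg_ln) auto
      qed (rule k)
      then have "(\<Sum>i\<le>r n. \<Sum>j\<le>r n. k (a i) (a j)) / Suc (r n)
          \<le> (c * (real (r n) * Suc (r n)) + M * Suc (r n)) / Suc (r n)"
        by (rule divide_right_mono) simp
      also have "c * (real (r n) * Suc (r n)) + M * Suc (r n) = (c * r n + M) * Suc (r n)"
        by (simp add: algebra_simps)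
      finally have 2: "(\<Sum>i\<le>r n. \<Sum>j\<le>r n. k (a i) (a j)) / Suc (r n) \<le> c * r n + M"
        by (simp only: nonzero_mult_div_cancel_right of_nat_eq_0_iff nat.simps not_False_eq_True)
      \<comment> \<open>The case n = 1 of the hypothesis gives 0 \<le> c.\<close>
      have "c * r n + M + Suc (r n) \<le> (c + 1) * Suc (r n) + M"
        using c[of 1] by (simp add: algebra_simps)
      with 1 2 have "(\<Sum>i\<le>r n. g (a i)) / Suc (r n) \<le> ((c + 1) * Suc (r n) + M) / Suc (r n)"
        by (intro divide_right_mono) linarith+
      also have "\<dots> = c + 1 + M / Suc (r n)"
        by (simp only: add_divide_distrib nonzero_mult_div_cancel_right of_nat_eq_0_iff nat.simps not_False_eq_True)
      finally show ?case .
    qed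
    have "(\<lambda>n. c + 1 + M / Suc (r n)) \<longlonglongrightarrow> c + 1 + 0"
    proof (intro tendsto_intros)
      have "(\<lambda>n. M / Suc n) \<longlonglongrightarrow> 0"
        using tendsto_mult_right_zero[OF LIMSEQ_inverse_real_of_nat, of "real M"] by (simp add: divide_inverse)
      then show "(\<lambda>n. M / Suc (r n)) \<longlonglongrightarrow> 0"
        using LIMSEQ_subseq_LIMSEQ[OF _ r] by (auto simp: o_def)
    qed
    then have "integral\<^sup>L \<mu> g \<le> c + 1"
      using tendsto_le[OF _ _ conv[OF contg] ev] g by (auto simp: bounded_iff)
    then show ?thesis by (simp add: g_def[abs_def] k_def[abs_def])
  qed
  then have "log_energy \<mu> \<noteq> - \<infinity>"
    by (rule log_energy_neq_minus_infinity[OF \<mu>(1,2)])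
  then show ?thesis
    using \<mu> unfolding polar_def by auto
qed

text \<open>Having the roots in K serves both applications: a contour off K stays at a fixed
  distance from all of them, and a Lipschitz image of K contains their images.\<close>

lemma polar_small_product:
  assumes K: "compact K" "polar K" "K \<noteq> {}" and \<kappa>: "0 < \<kappa>" "\<kappa> < 1"
  obtains n :: nat and a :: "nat \<Rightarrow> complex" where "n > 0" "\<And>i. i < n \<Longrightarrow> a i \<in> K"
    "\<And>z. z \<in> K \<Longrightarrow> (\<Prod>i<n. cmod (z - a i)) < \<kappa> ^ n"
proof (rule ccontr)
  note main = that
  assume contra: "\<not> thesis"
  have "\<exists>z. z \<in> K \<and> \<kappa> ^ n \<le> (\<Prod>i<n. cmod (z - f i))" if f: "\<forall>i<n. f i \<in> K" for n f
  proof (cases "n = 0")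
    case True
    then show ?thesis using \<open>K \<noteq> {}\<close> by auto
  next
    case False
    have "\<not> (\<forall>z\<in>K. (\<Prod>i<n. cmod (z - f i)) < \<kappa> ^ n)"
      using contra main[of n f] False f by auto
    then show ?thesis by (auto simp: not_less)
  qed
  then have "\<exists>a. \<forall>n. a n \<in> K \<and> \<kappa> ^ n \<le> (\<Prod>i<n. cmod (a n - a i))"
    by (intro dependent_wellorder_choice[where P = "\<lambda>f n z. z \<in> K \<and> \<kappa> ^ n \<le> (\<Prod>i<n. cmod (z - f i))"]) auto
  then obtain a where a: "\<And>n. a n \<in> K" "\<And>n. \<kappa> ^ n \<le> (\<Prod>i<n. cmod (a n - a i))" by blast
  have ne: "a n \<noteq> a i" if "i < n" for n i
  proof
    assume "a n = a i"
    then have "(\<Prod>i<n. cmod (a n - a i)) = 0" using that by (auto intro!: prod_zero)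
    with a(2)[of n] \<kappa> show False by (simp add: not_less[symmetric])
  qed
  \<comment> \<open>For 0 < t \<le> D with D \<ge> 1 the positive part of - ln t is at most ln D -
    ln t. Without the positive part the sum becomes the logarithm of a product, which the greedy
    choice bounds from below.\<close>
  obtain D where D: "D \<ge> 1" "\<And>z w. z \<in> K \<Longrightarrow> w \<in> K \<Longrightarrow> cmod (z - w) \<le> D"
  proof -
    have "cmod (z - w) \<le> max 1 (diameter K)" if "z \<in> K" "w \<in> K" for z w
      using diameter_bounded_bound[OF compact_imp_bounded[OF K(1)] that] by (auto simp: dist_norm)
    then show thesis by (intro that[of "max 1 (diameter K)"]) auto
  qed
  have "(\<Sum>i<n. max 0 (- ln (cmod (a n - a i)))) \<le> (ln D - ln \<kappa>) * n" for n
  proof -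
    have "(\<Sum>i<n. max 0 (- ln (cmod (a n - a i)))) \<le> (\<Sum>i<n. ln D - ln (cmod (a n - a i)))"
    proof (intro sum_mono)
      fix i assume "i \<in> {..<n}"
      then have "cmod (a n - a i) > 0" using ne by simp
      then have "ln (cmod (a n - a i)) \<le> ln D"
        using D a(1) by (subst ln_le_cancel_iff) auto
      then show "max 0 (- ln (cmod (a n - a i))) \<le> ln D - ln (cmod (a n - a i))"
        using D(1) by auto
    qed
    also have "\<dots> = n * ln D - ln (\<Prod>i<n. cmod (a n - a i))"
      using ne by (subst ln_prod) (auto simp: sum_subtractf)
    also have "\<dots> \<le> n * ln D - ln (\<kappa> ^ n)"
      using a(2)[of n] \<kappa> ne by (intro diff_left_mono, subst ln_le_cancel_iff) (auto intro!: prod_pos)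
    also have "\<dots> = (ln D - ln \<kappa>) * n"
      using \<kappa> by (simp add: ln_realpow algebra_simps)
    finally show ?thesis .
  qed
  then have "\<not> polar K" using ne by (intro not_polarI[where a = a, OF K(1) a(1)]) auto
  with K(2) show False by blast
qed

subsection \<open>Rectangles with boundaries off a polar set\<close>

text \<open>With u = x - c the primitive u ln |u| - u is continuous at u = 0 as well, so the
  singularity is a single exceptional point in the fundamental theorem.\<close>

lemma has_integral_ln_abs:
  fixes \<alpha> \<beta> c :: real
  assumes "\<alpha> \<le> \<beta>"
  shows "((\<lambda>x. ln \<bar>x - c\<bar>) has_integral
    ((\<beta> - c) * ln \<bar>\<beta> - c\<bar> - (\<beta> - c)) - ((\<alpha> - c) * ln \<bar>\<alpha> - c\<bar> - (\<alpha> - c))) {\<alpha>..\<beta>}"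
proof (rule fundamental_theorem_of_calculus_interior_strong[of "{c}"])
  have cont: "isCont (\<lambda>u. u * ln \<bar>u\<bar> :: real) u" for u
  proof (cases "u = 0")
    case True
    have "((\<lambda>u. u * ln \<bar>u\<bar> :: real) \<longlongrightarrow> 0) (at 0)"
      by (rule filterlim_split_at; real_asymp)
    then show ?thesis using True by (simp add: isCont_def)
  qed (auto intro!: continuous_intros)
  show "continuous_on {\<alpha>..\<beta>} (\<lambda>x. (x - c) * ln \<bar>x - c\<bar> - (x - c))"
    by (intro continuous_intros continuous_at_imp_continuous_on ballI
        isCont_o2[where f = "\<lambda>x. x - c" and g = "\<lambda>u. u * ln \<bar>u\<bar>"] cont)
next
  fix x assume x: "x \<in> {\<alpha><..<\<beta>} - {c}"
  have "((\<lambda>x. (x - c) * ln \<bar>x - c\<bar> - (x - c)) has_field_derivative ln \<bar>x - c\<bar>) (at x)"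
  proof (cases "x > c")
    case True
    have "((\<lambda>x. (x - c) * ln (x - c) - (x - c)) has_field_derivative ln \<bar>x - c\<bar>) (at x)"
      using True by (auto intro!: derivative_eq_intros)
    then show ?thesis
      by (rule has_field_derivative_transform_within_open[of _ _ _ "{c<..}"]) (use True in auto)
  next
    case False
    have "((\<lambda>x. (x - c) * ln (c - x) - (x - c)) has_field_derivative ln \<bar>x - c\<bar>) (at x)"
      using False x by (auto intro!: derivative_eq_intros simp: divide_simps)
    then show ?thesis
      by (rule has_field_derivative_transform_within_open[of _ _ _ "{..<c}"]) (use False x in auto)
  qed
  then show "((\<lambda>x. (x - c) * ln \<bar>x - c\<bar> - (x - c)) has_vector_derivative ln \<bar>x - c\<bar>) (at x)"
    by (simp add: has_real_derivative_iff_has_vector_derivative)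
qed (use assms in auto)

text \<open>This bounds the boundary terms of the logarithmic integral uniformly over all roots, so
  that the resulting constant does not depend on the degree.\<close>

lemma x_ln_abs_bound:
  fixes u D :: real
  assumes "\<bar>u\<bar> \<le> D" "D \<ge> 1"
  shows "\<bar>u * ln \<bar>u\<bar> - u\<bar> \<le> D * (D + 2)"
proof (cases "u = 0")
  case False
  have "\<bar>u * ln \<bar>u\<bar>\<bar> \<le> D * D + 1"
  proof (cases "\<bar>u\<bar> \<ge> 1")
    case True
    then have "0 \<le> ln \<bar>u\<bar>" "ln \<bar>u\<bar> \<le> D"
      using ln_bound[of "\<bar>u\<bar>"] assms False by auto
    then show ?thesis
      using assms mult_mono[of "\<bar>u\<bar>" D "ln \<bar>u\<bar>" D] by (simp add: abs_mult)
  next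
    case F: False
    have "- ln \<bar>u\<bar> = ln (inverse \<bar>u\<bar>)" by (simp add: ln_inverse)
    also have "\<dots> \<le> inverse \<bar>u\<bar>" using False by (intro ln_bound) auto
    finally have "\<bar>u\<bar> * (- ln \<bar>u\<bar>) \<le> \<bar>u\<bar> * inverse \<bar>u\<bar>"
      by (intro mult_left_mono) auto
    moreover have "ln \<bar>u\<bar> \<le> 0" using F False by simp
    ultimately have "\<bar>u * ln \<bar>u\<bar>\<bar> \<le> 1" using False by (simp add: abs_mult)
    then show ?thesis using assms by (smt (verit) mult_nonneg_nonneg)
  qed
  then show ?thesis using assms by (simp add: algebra_simps)
qed (use assms in auto)

text \<open>Applying the 1-Lipschitz map h to the argument and to the roots of a polynomial that is small
  on K does not increase the product of the distances. On an interval, that product cannot be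
  arbitrarily small, because the logarithm is integrable.\<close>
lemma polar_lipschitz_image_misses:
  fixes h :: "complex \<Rightarrow> real"
  assumes K: "compact K" "polar K" and h: "\<And>z w. \<bar>h z - h w\<bar> \<le> cmod (z - w)" and "\<alpha> < \<beta>"
  obtains c where "\<alpha> < c" "c < \<beta>" "c \<notin> h ` K"
proof (rule ccontr)
  note main = that
  assume contra: "\<not> thesis"
  have sub: "{\<alpha><..<\<beta>} \<subseteq> h ` K"
    using contra main by (meson greaterThanLessThan_iff subsetI)
  then have "K \<noteq> {}" using \<open>\<alpha> < \<beta>\<close> by auto
  have "bounded (h ` K)"
  proof -
    have "continuous_on K h"
      by (rule lipschitz_on_continuous_on[of 1])
        (use h in \<open>auto intro!: lipschitz_onI simp: dist_real_def dist_norm\<close>)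
    then show ?thesis
      using K(1) by (intro compact_imp_bounded compact_continuous_image)
  qed
  then obtain R where R: "R > 0" "\<And>z. z \<in> K \<Longrightarrow> \<bar>h z\<bar> \<le> R"
    by (auto simp: bounded_pos)
  define D where "D = 1 + R + \<bar>\<alpha>\<bar> + \<bar>\<beta>\<bar>"
  define C where "C = 2 * (D * (D + 2))"
  have D: "D \<ge> 1" using R by (simp add: D_def)
  have C: "C > 0" using D by (simp add: C_def add_pos_pos)
  \<comment> \<open>With this choice the integral of the logarithm of the product is at most - 2 C
    n, whereas the boundary terms show that it is at least - C n.\<close>
  define \<kappa> where "\<kappa> = exp (- 2 * C / (\<beta> - \<alpha>))"
  have \<kappa>: "0 < \<kappa>" "\<kappa> < 1"
    using C \<open>\<alpha> < \<beta>\<close> by (auto simp: \<kappa>_def divide_simps)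
  obtain n and a :: "nat \<Rightarrow> complex" where n: "n > 0" "\<And>i. i < n \<Longrightarrow> a i \<in> K"
    "\<And>z. z \<in> K \<Longrightarrow> (\<Prod>i<n. cmod (z - a i)) < \<kappa> ^ n"
    using polar_small_product[OF K \<open>K \<noteq> {}\<close> \<kappa>] by blast
  define J where "J c = ((\<beta> - c) * ln \<bar>\<beta> - c\<bar> - (\<beta> - c)) - ((\<alpha> - c) * ln \<bar>\<alpha> - c\<bar> - (\<alpha> - c))" for c
  \<comment> \<open>The integrand is overwritten at finitely many points: at the endpoints, which
    need not lie in the image of K, and at the images of the roots, where \<open>ln 0 = 0\<close>
    could break the comparison.\<close>
  define S where "S = insert \<alpha> (insert \<beta> ((\<lambda>i. h (a i)) ` {..<n}))"
  have "finite S" by (simp add: S_def)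
  have i1: "((\<lambda>x. \<Sum>i<n. ln \<bar>x - h (a i)\<bar>) has_integral (\<Sum>i<n. J (h (a i)))) {\<alpha>..\<beta>}"
    using \<open>\<alpha> < \<beta>\<close> unfolding J_def by (intro has_integral_sum has_integral_ln_abs) auto
  have i1': "((\<lambda>x. if x \<in> S then n * ln \<kappa> else \<Sum>i<n. ln \<bar>x - h (a i)\<bar>) has_integral (\<Sum>i<n. J (h (a i)))) {\<alpha>..\<beta>}"
    by (rule has_integral_spike_finite[OF \<open>finite S\<close> _ i1]) auto
  have i2: "((\<lambda>x. n * ln \<kappa>) has_integral ((\<beta> - \<alpha>) * (n * ln \<kappa>))) {\<alpha>..\<beta>}"
    using has_integral_const_real[of "n * ln \<kappa>" \<alpha> \<beta>] \<open>\<alpha> < \<beta>\<close> by simp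
  have "(\<Sum>i<n. J (h (a i))) \<le> (\<beta> - \<alpha>) * (n * ln \<kappa>)"
  proof (rule has_integral_le[OF i1' i2])
    fix x assume x: "x \<in> {\<alpha>..\<beta>}"
    show "(if x \<in> S then n * ln \<kappa> else \<Sum>i<n. ln \<bar>x - h (a i)\<bar>) \<le> n * ln \<kappa>"
    proof (cases "x \<in> S")
      case False
      then have "x \<in> {\<alpha><..<\<beta>}" using x by (auto simp: S_def)
      then obtain z where z: "z \<in> K" "x = h z" using sub by auto
      have pos: "0 < \<bar>x - h (a i)\<bar>" if "i < n" for i
        using False that by (auto simp: S_def)
      have "(\<Sum>i<n. ln \<bar>x - h (a i)\<bar>) = ln (\<Prod>i<n. \<bar>x - h (a i)\<bar>)"
        using pos by (subst ln_prod) auto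
      also have "\<dots> \<le> ln (\<kappa> ^ n)"
      proof (subst ln_le_cancel_iff)
        have "(\<Prod>i<n. \<bar>x - h (a i)\<bar>) \<le> (\<Prod>i<n. cmod (z - a i))"
          using h z by (intro prod_mono) auto
        with n(3)[OF z(1)] show "(\<Prod>i<n. \<bar>x - h (a i)\<bar>) \<le> \<kappa> ^ n" by simp
      qed (use pos \<kappa> in \<open>auto intro!: prod_pos\<close>)
      also have "\<dots> = n * ln \<kappa>" using \<kappa> by (simp add: ln_realpow)
      finally show ?thesis using False by simp
    qed auto
  qed
  moreover have "(\<Sum>i<n. J (h (a i))) \<ge> (\<Sum>i<n. - C)"
  proof (intro sum_mono)
    fix i assume "i \<in> {..<n}"
    then have "\<bar>h (a i)\<bar> \<le> R" using R n(2) by auto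
    then have "\<bar>\<beta> - h (a i)\<bar> \<le> D" "\<bar>\<alpha> - h (a i)\<bar> \<le> D"
      by (auto simp: D_def)
    from this[THEN x_ln_abs_bound, OF D] show "- C \<le> J (h (a i))"
      by (simp add: J_def C_def abs_le_iff)
  qed
  moreover have "(\<beta> - \<alpha>) * (n * ln \<kappa>) = - 2 * C * n"
    using \<open>\<alpha> < \<beta>\<close> by (simp add: \<kappa>_def)
  moreover have "(\<Sum>i<n. - C) = - (C * n)" by simp
  ultimately have "- (C * n) \<le> - 2 * C * n" by linarith
  then show False using C n(1) by simp
qed

section \<open>Grids whose lines avoid a polar set\<close>

lemma strict_partition_exists:
  assumes "\<delta> > 0" and miss: "\<And>\<alpha> \<beta> :: real. \<alpha> < \<beta> \<Longrightarrow> \<exists>c. \<alpha> < c \<and> c < \<beta> \<and> c \<notin> X"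
  obtains c :: "int \<Rightarrow> real" where "\<And>k. c k \<notin> X" "\<And>k. of_int k * \<delta> < c k" "\<And>k. c k < (of_int k + 1) * \<delta>"
proof -
  have "\<exists>c. c \<notin> X \<and> of_int k * \<delta> < c \<and> c < (of_int k + 1) * \<delta>" for k :: int
    using miss[of "of_int k * \<delta>" "(of_int k + 1) * \<delta>"] \<open>\<delta> > 0\<close> by (auto simp: algebra_simps)
  then show thesis using that by metis
qed

text \<open>For j the integer part of \<open>x / \<delta>\<close>, the node \<open>c j\<close> lies
  in the same slot as x. Hence x belongs to the cell to the right or to the left of this
  node.\<close>

lemma partition_cell:
  fixes c :: "int \<Rightarrow> real"
  assumes "\<delta> > 0" and c: "\<And>k. of_int k * \<delta> < c k" "\<And>k. c k < (of_int k + 1) * \<delta>"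
    and x: "x \<notin> range c"
  shows "\<exists>k. c k < x \<and> x < c (k + 1)"
proof -
  define j where "j = \<lfloor>x / \<delta>\<rfloor>"
  have "of_int j \<le> x / \<delta>" "x / \<delta> < of_int j + 1"
    by (simp_all add: j_def)
  then have j: "of_int j * \<delta> \<le> x" "x < (of_int j + 1) * \<delta>"
    using \<open>\<delta> > 0\<close> by (simp_all add: field_simps)
  show ?thesis
  proof (cases "c j < x")
    case True
    moreover have "x < c (j + 1)"
      using j(2) c(1)[of "j + 1"] by simp
    ultimately show ?thesis by blast
  next
    case False
    moreover have "x \<noteq> c j" using x by blast
    moreover have "c (j - 1) < x"
      using j(1) c(2)[of "j - 1"] by simp
    ultimately show ?thesis by (intro exI[of _ "j - 1"]) auto
  qed
qed

text \<open>No grid line meets K, so a point of K is interior to its cell and lies outside every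
  other closed cell. This makes the sum of Cauchy integrals over all boxes count each point of K
  exactly once.\<close>

lemma polar_box_cover:
  assumes K: "compact K" "polar K" and W: "open W" "K \<subseteq> W"
  obtains B :: "(complex \<times> complex) set" where "finite B"
    "\<And>a b. (a, b) \<in> B \<Longrightarrow> Re a < Re b \<and> Im a < Im b \<and> cbox a b \<subseteq> W"
    "\<And>z. z \<in> K \<Longrightarrow> \<exists>p\<in>B. z \<in> box (fst p) (snd p) \<and> (\<forall>q\<in>B - {p}. z \<notin> cbox (fst q) (snd q))"
proof -
  obtain e where e: "e > 0" "(\<Union>x\<in>K. ball x e) \<subseteq> W"
    using compact_subset_open_imp_ball_epsilon_subset[OF K(1) W] by blast
  \<comment> \<open>Adjacent nodes are at most 2 \<open>\<delta>\<close> apart, so the real and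
    imaginary differences to a point inside the cell add up to less than 4 \<open>\<delta>\<close> =
    e.\<close>
  define \<delta> where "\<delta> = e / 4"
  have \<delta>: "\<delta> > 0" using e by (simp add: \<delta>_def)
  have lip: "\<bar>Re z - Re w\<bar> \<le> cmod (z - w)" "\<bar>Im z - Im w\<bar> \<le> cmod (z - w)" for z w
    using abs_Re_le_cmod[of "z - w"] abs_Im_le_cmod[of "z - w"] by auto
  obtain c where c: "\<And>k. c k \<notin> Re ` K" "\<And>k. of_int k * \<delta> < c k" "\<And>k. c k < (of_int k + 1) * \<delta>"
    using strict_partition_exists[OF \<delta>, of "Re ` K"] polar_lipschitz_image_misses[OF K, of Re] lip by metis
  obtain d where d: "\<And>k. d k \<notin> Im ` K" "\<And>k. of_int k * \<delta> < d k" "\<And>k. d k < (of_int k + 1) * \<delta>"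
    using strict_partition_exists[OF \<delta>, of "Im ` K"] polar_lipschitz_image_misses[OF K, of Im] lip by metis
  have mono: "u k \<le> u l" if "k \<le> l" "\<And>k. of_int k * \<delta> < u k" "\<And>k. u k < (of_int k + 1) * \<delta>" for u :: "int \<Rightarrow> real" and k l
  proof (cases "k = l")
    case False
    then have "(of_int k + 1) * \<delta> \<le> of_int l * \<delta>"
      using that(1) \<delta> by (intro mult_right_mono) auto
    then show ?thesis using that(2)[of l] that(3)[of k] by simp
  qed auto
  note cm = mono[OF _ c(2,3)] and dm = mono[OF _ d(2,3)]
  have step: "c k < c (k + 1)" "d k < d (k + 1)" for k
    using c(2)[of "k + 1"] c(3)[of k] d(2)[of "k + 1"] d(3)[of k] by auto
  have wd: "c (k + 1) - c k \<le> 2 * \<delta>" "d (k + 1) - d k \<le> 2 * \<delta>" for k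
    using c(2)[of k] c(3)[of "k + 1"] d(2)[of k] d(3)[of "k + 1"] by (auto simp: algebra_simps)
  define lo hi where "lo p = Complex (c (fst p)) (d (snd p))"
    and "hi p = Complex (c (fst p + 1)) (d (snd p + 1))" for p
  define I where "I = {p. box (lo p) (hi p) \<inter> K \<noteq> {}}"
  obtain R where R: "R > 0" "\<And>z. z \<in> K \<Longrightarrow> norm z \<le> R"
    using compact_imp_bounded[OF K(1)] by (auto simp: bounded_pos)
  have fin: "finite I"
  proof -
    define m where "m = \<lceil>R / \<delta>\<rceil>"
    have "R / \<delta> \<le> of_int m" unfolding m_def by (rule le_of_int_ceiling)
    then have m: "R \<le> of_int m * \<delta>" using \<delta> by (simp add: field_simps)
    have bnd: "k \<in> {- m - 2..m}" if "of_int k * \<delta> < x" "x < (2 + of_int k) * \<delta>" "\<bar>x\<bar> \<le> R" for x k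
    proof -
      have "(- of_int m - 2) * \<delta> = - (of_int m * \<delta>) - 2 * \<delta>" "(2 + of_int k) * \<delta> = of_int k * \<delta> + 2 * \<delta>"
        by (simp_all add: algebra_simps)
      then have "of_int k * \<delta> < of_int m * \<delta>" "(- of_int m - 2) * \<delta> < of_int k * \<delta>"
        using that m by linarith+
      then have "of_int k < (of_int m :: real)" "(- of_int m - 2) < (of_int k :: real)"
        using \<delta> by auto
      then show ?thesis by simp
    qed
    have "I \<subseteq> {- m - 2..m} \<times> {- m - 2..m}"
    proof
      fix p assume "p \<in> I"
      then obtain z where z: "z \<in> K" "z \<in> box (lo p) (hi p)" by (auto simp: I_def)
      have "\<bar>Re z\<bar> \<le> R" "\<bar>Im z\<bar> \<le> R"
        using R(2)[OF z(1)] abs_Re_le_cmod[of z] abs_Im_le_cmod[of z] by auto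
      moreover have "c (fst p) < Re z" "Re z < c (fst p + 1)" "d (snd p) < Im z" "Im z < d (snd p + 1)"
        using z(2) by (auto simp: in_box_complex_iff lo_def hi_def)
      ultimately have "fst p \<in> {- m - 2..m}" "snd p \<in> {- m - 2..m}"
        using c(2)[of "fst p"] c(3)[of "fst p + 1"] d(2)[of "snd p"] d(3)[of "snd p + 1"]
        by - ((rule bnd[of _ "Re z"]; simp), (rule bnd[of _ "Im z"]; simp))
      then show "p \<in> {- m - 2..m} \<times> {- m - 2..m}" by (simp add: mem_Times_iff)
    qed
    then show ?thesis by (rule finite_subset) simp
  qed
  show thesis
  proof (rule that[of "(\<lambda>p. (lo p, hi p)) ` I"])
    fix a b assume "(a, b) \<in> (\<lambda>p. (lo p, hi p)) ` I"
    then obtain p where p: "p \<in> I" "a = lo p" "b = hi p" by blast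
    then obtain z where z: "z \<in> K" "z \<in> box (lo p) (hi p)" by (auto simp: I_def)
    have "cbox a b \<subseteq> ball z e"
    proof
      fix w assume w: "w \<in> cbox a b"
      have "\<bar>Re (z - w)\<bar> \<le> 2 * \<delta>" "\<bar>Im (z - w)\<bar> < 2 * \<delta>"
        using w z(2) wd[of "fst p"] wd[of "snd p"]
        by (auto simp: p in_box_complex_iff in_cbox_complex_iff lo_def hi_def abs_le_iff)
      then have "cmod (z - w) < 4 * \<delta>"
        using cmod_le[of "z - w"] by simp
      then show "w \<in> ball z e" by (simp add: \<delta>_def dist_norm)
    qed
    also have "ball z e \<subseteq> W" using e(2) z(1) by blast
    finally show "Re a < Re b \<and> Im a < Im b \<and> cbox a b \<subseteq> W"
      using step by (simp add: p lo_def hi_def)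
  next
    fix z assume z: "z \<in> K"
    have nr: "Re z \<notin> range c" "Im z \<notin> range d" using c(1) d(1) z by (metis image_eqI rangeE)+
    obtain k l where kl: "c k < Re z" "Re z < c (k + 1)" "d l < Im z" "Im z < d (l + 1)"
      using partition_cell[OF \<delta> c(2,3) nr(1)] partition_cell[OF \<delta> d(2,3) nr(2)] by blast
    have zb: "z \<in> box (lo (k, l)) (hi (k, l))"
      using kl by (simp add: in_box_complex_iff lo_def hi_def)
    moreover have "(k', l') = (k, l)" if "z \<in> cbox (lo (k', l')) (hi (k', l'))" for k' l'
    proof -
      have *: "c k' \<le> Re z" "Re z \<le> c (k' + 1)" "d l' \<le> Im z" "Im z \<le> d (l' + 1)"
        using that by (auto simp: in_cbox_complex_iff lo_def hi_def)
      have "\<not> k + 1 \<le> k'" "\<not> k' + 1 \<le> k" "\<not> l + 1 \<le> l'" "\<not> l' + 1 \<le> l"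
        using * kl cm[of "k + 1" k'] cm[of "k' + 1" k] dm[of "l + 1" l'] dm[of "l' + 1" l] by auto
      then show ?thesis by auto
    qed
    ultimately show "\<exists>p\<in>(\<lambda>p. (lo p, hi p)) ` I. z \<in> box (fst p) (snd p) \<and>
        (\<forall>q\<in>(\<lambda>p. (lo p, hi p)) ` I - {p}. z \<notin> cbox (fst q) (snd q))"
      using z by (intro bexI[of _ "(lo (k, l), hi (k, l))"]) (force simp: I_def)+
  qed (use fin in auto)
qed

subsection \<open>Interpolation\<close>

text \<open>This is Newton interpolation of the Cauchy kernel in \<open>z\<close> with the Hermite
  remainder. No difference of two nodes is inverted, so nodes may repeat, as they do when a fixed
  set of roots is used many times.\<close>

lemma newton_cauchy_kernel:
  fixes a :: "nat \<Rightarrow> 'a::field"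
  assumes "w \<noteq> z" "\<And>i. i < m \<Longrightarrow> w \<noteq> a i"
  shows "1 / (w - z) = (\<Sum>k<m. (\<Prod>i<k. z - a i) / (\<Prod>i<Suc k. w - a i))
    + (\<Prod>i<m. z - a i) / ((\<Prod>i<m. w - a i) * (w - z))"
  using assms(2)
proof (induction m)
  case 0
  then show ?case by simp
next
  case (Suc m)
  have split: "p * (v + x) / (q * u * v) = p / (q * u) + p * x / (q * u * v)" if "v \<noteq> 0" for p q u v x :: 'a
    using that by (simp add: distrib_left add_divide_distrib)
  have nz: "(\<Prod>i<m. w - a i) \<noteq> 0" "w - a m \<noteq> 0" "w - z \<noteq> 0"
    using Suc.prems assms(1) by auto
  have "(\<Prod>i<m. z - a i) / ((\<Prod>i<m. w - a i) * (w - z))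
      = (\<Prod>i<m. z - a i) * ((w - z) + (z - a m)) / ((\<Prod>i<m. w - a i) * (w - a m) * (w - z))"
    using nz by simp
  also have "\<dots> = (\<Prod>i<m. z - a i) / (\<Prod>i<Suc m. w - a i)
      + (\<Prod>i<Suc m. z - a i) / ((\<Prod>i<Suc m. w - a i) * (w - z))"
    by (simp only: split[OF nz(3)] prod.lessThan_Suc)
  finally show ?case using Suc by simp
qed

lemma contour_integral_rectpath_bound:
  fixes a b :: complex
  obtains L where "L \<ge> 0"
    "\<And>f B. continuous_on (path_image (rectpath a b)) f \<Longrightarrow> 0 \<le> B \<Longrightarrow>
       (\<And>w. w \<in> path_image (rectpath a b) \<Longrightarrow> cmod (f w) \<le> B) \<Longrightarrow>
       cmod (contour_integral (rectpath a b) f) \<le> L * B"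
proof -
  define c d where "c = Complex (Re b) (Im a)" and "d = Complex (Re a) (Im b)"
  have rp: "rectpath a b = linepath a c +++ linepath c b +++ linepath b d +++ linepath d a"
    by (simp add: rectpath_def c_def d_def Let_def)
  have pi: "path_image (rectpath a b) =
      closed_segment a c \<union> closed_segment c b \<union> closed_segment b d \<union> closed_segment d a"
    by (auto simp: rp path_image_join)
  show thesis
  proof (rule that[of "cmod (c - a) + cmod (b - c) + cmod (d - b) + cmod (a - d)"])
    fix f B
    assume f: "continuous_on (path_image (rectpath a b)) f" and B: "0 \<le> B"
      "\<And>w. w \<in> path_image (rectpath a b) \<Longrightarrow> cmod (f w) \<le> B"
    have i: "f contour_integrable_on linepath u v" if "closed_segment u v \<subseteq> path_image (rectpath a b)" for u v
      using that f by (intro contour_integrable_continuous_linepath) (rule continuous_on_subset)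
    have n: "cmod (contour_integral (linepath u v) f) \<le> B * cmod (v - u)"
      if "closed_segment u v \<subseteq> path_image (rectpath a b)" for u v
      using that B by (intro contour_integral_bound_linepath i) auto
    have s: "closed_segment a c \<subseteq> path_image (rectpath a b)" "closed_segment c b \<subseteq> path_image (rectpath a b)"
      "closed_segment b d \<subseteq> path_image (rectpath a b)" "closed_segment d a \<subseteq> path_image (rectpath a b)"
      by (auto simp: pi)
    have "contour_integral (rectpath a b) f = contour_integral (linepath a c) f + (contour_integral (linepath c b) f
        + (contour_integral (linepath b d) f + contour_integral (linepath d a) f))"
      unfolding rp using s[THEN i] by (simp add: contour_integrable_join)
    also have "cmod \<dots> \<le> B * cmod (c - a) + (B * cmod (b - c) + (B * cmod (d - b) + B * cmod (a - d)))"
      by (intro norm_triangle_mono n s)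
    finally show "cmod (contour_integral (rectpath a b) f)
        \<le> (cmod (c - a) + cmod (b - c) + cmod (d - b) + cmod (a - d)) * B"
      by (simp add: algebra_simps)
  qed simp
qed

text \<open>Integrating the Newton expansion of the Cauchy kernel against f gives an interpolation
  polynomial plus Hermite's remainder. What matters is the order of choices:
  \<open>\<Gamma>\<close>, \<open>C\<close> and \<open>\<rho>\<close> precede f, the number of nodes
  and the nodes.\<close>

lemma polynomial_interpolation_bound:
  assumes K: "compact K" "polar K" and W: "open W" "K \<subseteq> W"
  obtains \<Gamma> :: "complex set" and C \<rho> :: real where "compact \<Gamma>" "\<Gamma> \<subseteq> W" "C > 0" "\<rho> > 0"
    "\<And>f M a m. f holomorphic_on W \<Longrightarrow> (\<And>w. w \<in> \<Gamma> \<Longrightarrow> cmod (f w) \<le> M) \<Longrightarrow> 0 \<le> M \<Longrightarrow>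
      (\<And>i :: nat. i < m \<Longrightarrow> a i \<in> K) \<Longrightarrow>
      \<exists>Q. (\<forall>k\<ge>m. coeff Q k = 0) \<and>
        (\<forall>z\<in>K. cmod (poly Q z - f z) \<le> C * M * (\<Prod>i<m. cmod (z - a i)) / \<rho> ^ m)"
proof -
  obtain B :: "(complex \<times> complex) set" where B: "finite B"
    "\<And>a b. (a, b) \<in> B \<Longrightarrow> Re a < Re b \<and> Im a < Im b \<and> cbox a b \<subseteq> W"
    "\<And>z. z \<in> K \<Longrightarrow> \<exists>p\<in>B. z \<in> box (fst p) (snd p) \<and> (\<forall>q\<in>B - {p}. z \<notin> cbox (fst q) (snd q))"
    using polar_box_cover[OF K W] by metis
  define g where "g p = rectpath (fst p) (snd p)" for p :: "complex \<times> complex"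
  define \<Gamma> where "\<Gamma> = (\<Union>p\<in>B. path_image (g p))"
  have pig: "path_image (g p) = cbox (fst p) (snd p) - box (fst p) (snd p)" if "p \<in> B" for p
    unfolding g_def using B(2)[of "fst p" "snd p"] that by (intro path_image_rectpath_cbox_minus_box) auto
  have g[simp]: "valid_path (g p)" "pathfinish (g p) = pathstart (g p)" for p
    by (simp_all add: g_def)
  have \<Gamma>: "compact \<Gamma>" "\<Gamma> \<subseteq> W" "\<Gamma> \<inter> K = {}"
  proof -
    show "compact \<Gamma>" unfolding \<Gamma>_def using B(1) by (intro compact_UN) (auto simp: compact_valid_path_image)
    show "\<Gamma> \<subseteq> W" using B(2) by (fastforce simp: \<Gamma>_def pig)
    show "\<Gamma> \<inter> K = {}"
    proof (rule ccontr)
      assume "\<Gamma> \<inter> K \<noteq> {}"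
      then obtain z q where z: "z \<in> K" "q \<in> B" "z \<in> path_image (g q)" by (auto simp: \<Gamma>_def)
      obtain p where "p \<in> B" "z \<in> box (fst p) (snd p)" "\<forall>q\<in>B - {p}. z \<notin> cbox (fst q) (snd q)"
        using B(3)[OF z(1)] by blast
      then show False using z pig by (cases "q = p") auto
    qed
  qed
  obtain \<rho> where \<rho>: "\<rho> > 0" "\<And>w z. w \<in> \<Gamma> \<Longrightarrow> z \<in> K \<Longrightarrow> \<rho> \<le> cmod (w - z)"
    using separate_compact_closed[OF \<Gamma>(1) compact_imp_closed[OF K(1)] \<Gamma>(3)] by (auto simp: dist_norm)
  have "\<exists>L\<ge>0. \<forall>f M. continuous_on (path_image (g p)) f \<longrightarrow> 0 \<le> M \<longrightarrow> (\<forall>w\<in>path_image (g p). cmod (f w) \<le> M) \<longrightarrow>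
       cmod (contour_integral (g p) f) \<le> L * M" for p
    unfolding g_def by (rule contour_integral_rectpath_bound[of "fst p" "snd p"]) blast
  then obtain L where L: "\<And>p. L p \<ge> 0" "\<And>p f M. continuous_on (path_image (g p)) f \<Longrightarrow> 0 \<le> M \<Longrightarrow>
      (\<And>w. w \<in> path_image (g p) \<Longrightarrow> cmod (f w) \<le> M) \<Longrightarrow> cmod (contour_integral (g p) f) \<le> L p * M"
    by metis
  \<comment> \<open>Division by \<open>\<rho>\<close> accounts for the factor w - z in the
    remainder; adding 1 makes C positive even if \<open>B\<close> is empty.\<close>
  define C where "C = (\<Sum>p\<in>B. L p) / \<rho> + 1"
  have "C > 0" unfolding C_def using L(1) \<rho> by (intro add_nonneg_pos divide_nonneg_pos sum_nonneg) auto
  define I where "I f = (\<Sum>p\<in>B. contour_integral (g p) f)" for f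
  have sub: "path_image (g p) \<subseteq> W - K" if "p \<in> B" for p
    using \<Gamma> that by (auto simp: \<Gamma>_def)
  have openWK: "open (W - K)" using W K by (simp add: compact_imp_closed open_Diff)
  have int: "f contour_integrable_on g p" if "f holomorphic_on W - K" "p \<in> B" for f p
    using contour_integrable_holomorphic_simple[OF that(1) openWK _ sub[OF that(2)]] by simp
  \<comment> \<open>Only the box around z contributes. For every other box z is outside the closed
    box, the integrand is holomorphic on it, and its integral vanishes.\<close>
  have cauchy: "I (\<lambda>w. f w / (w - z)) = 2 * pi * \<i> * f z" if f: "f holomorphic_on W" and z: "z \<in> K" for f z
  proof -
    obtain p where p: "p \<in> B" "z \<in> box (fst p) (snd p)" "\<And>q. q \<in> B - {p} \<Longrightarrow> z \<notin> cbox (fst q) (snd q)"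
      using B(3)[OF z(1)] by blast
    have fc: "f holomorphic_on cbox (fst q) (snd q)" if "q \<in> B" for q
      using B(2)[of "fst q" "snd q"] that f by (auto intro: holomorphic_on_subset)
    have "I (\<lambda>w. f w / (w - z)) = (\<Sum>q\<in>B. if q = p then 2 * pi * \<i> * f z else 0)"
      unfolding I_def
    proof (intro sum.cong refl contour_integral_unique)
      fix q assume q: "q \<in> B"
      show "((\<lambda>w. f w / (w - z)) has_contour_integral (if q = p then 2 * pi * \<i> * f z else 0)) (g q)"
      proof (cases "q = p")
        case True
        have "((\<lambda>w. f w / (w - z)) has_contour_integral (2 * pi * \<i> * winding_number (g p) z * f z)) (g p)"
          using p by (intro Cauchy_integral_formula_convex_simple[OF _ fc[OF p(1)]]) (auto simp: pig interior_cbox)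
        then show ?thesis
          using True winding_number_rectpath[OF p(2)] by (simp add: g_def)
      next
        case False
        have "(\<lambda>w. f w / (w - z)) holomorphic_on cbox (fst q) (snd q)"
          using p(3)[of q] q False by (intro holomorphic_intros fc) auto
        then have "((\<lambda>w. f w / (w - z)) has_contour_integral 0) (g q)"
          using q by (intro Cauchy_theorem_convex_simple[of _ "cbox (fst q) (snd q)"]) (auto simp: pig)
        then show ?thesis using False by simp
      qed
    qed
    then show ?thesis using p(1) B(1) by simp
  qed
  have main: "\<exists>Q. (\<forall>k\<ge>m. coeff Q k = 0) \<and>
        (\<forall>z\<in>K. cmod (poly Q z - f z) \<le> C * M * (\<Prod>i<m. cmod (z - a i)) / \<rho> ^ m)"
    if f: "f holomorphic_on W" and M: "\<And>w. w \<in> \<Gamma> \<Longrightarrow> cmod (f w) \<le> M" "0 \<le> M"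
      and a: "\<And>i. i < m \<Longrightarrow> a i \<in> K" for f M and a :: "nat \<Rightarrow> complex" and m
  proof -
    \<comment> \<open>Newton form, with contour integrals in place of divided differences as
      coefficients.\<close>
    define Q where "Q = (\<Sum>k<m. smult (I (\<lambda>w. f w / (\<Prod>i<Suc k. w - a i)) / (2 * pi * \<i>)) (\<Prod>i<k. [:- a i, 1:]))"
    have fWK: "f holomorphic_on W - K" using f by (rule holomorphic_on_subset) auto
    have "coeff Q k = 0" if "k \<ge> m" for k
    proof -
      have "coeff (\<Prod>i<j. [:- a i, 1:]) k = 0" if "j < m" for j
      proof (rule coeff_eq_0)
        have "degree (\<Prod>i<j. [:- a i, 1:]) \<le> (\<Sum>i<j. degree [:- a i, 1:])"
          using degree_prod_sum_le[of "{..<j}" "\<lambda>i. [:- a i, 1:]"] by (simp add: o_def)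
        then show "degree (\<Prod>i<j. [:- a i, 1:]) < k" using that \<open>k \<ge> m\<close> by simp
      qed
      then show ?thesis by (simp add: Q_def coeff_sum)
    qed
    moreover have "cmod (poly Q z - f z) \<le> C * M * (\<Prod>i<m. cmod (z - a i)) / \<rho> ^ m" if z: "z \<in> K" for z
    proof -
      define q where "q k w = (\<Prod>i<k. w - a i)" for k w
      have q0: "q k w \<noteq> 0" if "w \<notin> K" "k \<le> m" for k w
        using that a by (force simp: q_def)
      have qhol: "(\<lambda>w. f w / q k w) holomorphic_on W - K" if "k \<le> m" for k
        using q0 that unfolding q_def by (intro holomorphic_intros fWK) auto
      have rhol: "(\<lambda>w. f w / (q m w * (w - z))) holomorphic_on W - K"
        using q0[of _ m] z unfolding q_def by (intro holomorphic_intros fWK) auto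
      have "contour_integral (g p) (\<lambda>w. f w / (w - z))
          = (\<Sum>k<m. q k z * contour_integral (g p) (\<lambda>w. f w / q (Suc k) w))
            + q m z * contour_integral (g p) (\<lambda>w. f w / (q m w * (w - z)))" if p: "p \<in> B" for p
      proof -
        have "contour_integral (g p) (\<lambda>w. f w / (w - z)) =
            contour_integral (g p) (\<lambda>w. (\<Sum>k<m. q k z * (f w / q (Suc k) w)) + q m z * (f w / (q m w * (w - z))))"
        proof (rule contour_integral_eq)
          fix w assume "w \<in> path_image (g p)"
          then have "w \<notin> K" using sub[OF p] by blast
          then have "1 / (w - z) = (\<Sum>k<m. q k z / q (Suc k) w) + q m z / (q m w * (w - z))"
            unfolding q_def using z a by (intro newton_cauchy_kernel) auto
          then have "f w * (1 / (w - z)) = f w * ((\<Sum>k<m. q k z / q (Suc k) w) + q m z / (q m w * (w - z)))"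
            by simp
          then show "f w / (w - z) = (\<Sum>k<m. q k z * (f w / q (Suc k) w)) + q m z * (f w / (q m w * (w - z)))"
            by (simp add: distrib_left sum_distrib_left mult_ac)
        qed
        also have "\<dots> = (\<Sum>k<m. q k z * contour_integral (g p) (\<lambda>w. f w / q (Suc k) w))
            + q m z * contour_integral (g p) (\<lambda>w. f w / (q m w * (w - z)))"
          using p by (intro contour_integral_unique has_contour_integral_add has_contour_integral_sum
              has_contour_integral_lmul has_contour_integral_integral int qhol rhol) auto
        finally show ?thesis .
      qed
      then have "I (\<lambda>w. f w / (w - z)) = (\<Sum>p\<in>B. \<Sum>k<m. q k z * contour_integral (g p) (\<lambda>w. f w / q (Suc k) w))
          + q m z * I (\<lambda>w. f w / (q m w * (w - z)))"
        by (simp add: I_def sum.distrib sum_distrib_left)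
      also have "(\<Sum>p\<in>B. \<Sum>k<m. q k z * contour_integral (g p) (\<lambda>w. f w / q (Suc k) w))
          = (\<Sum>k<m. q k z * I (\<lambda>w. f w / q (Suc k) w))"
        unfolding I_def sum_distrib_left by (rule sum.swap)
      also have "\<dots> = 2 * pi * \<i> * poly Q z"
        by (simp add: Q_def poly_sum poly_prod q_def sum_distrib_left mult_ac)
      finally have "2 * pi * \<i> * (f z - poly Q z) = q m z * I (\<lambda>w. f w / (q m w * (w - z)))"
        by (simp add: cauchy[OF f z] algebra_simps)
      then have "cmod (2 * pi * \<i> * (f z - poly Q z)) = cmod (q m z * I (\<lambda>w. f w / (q m w * (w - z))))"
        by simp
      then have 1: "2 * pi * cmod (f z - poly Q z) = cmod (q m z) * cmod (I (\<lambda>w. f w / (q m w * (w - z))))"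
        by (simp add: norm_mult)
      have "cmod (I (\<lambda>w. f w / (q m w * (w - z)))) \<le> (\<Sum>p\<in>B. L p * (M / (\<rho> ^ m * \<rho>)))"
        unfolding I_def
      proof (rule sum_norm_le)
        fix p assume p: "p \<in> B"
        show "cmod (contour_integral (g p) (\<lambda>w. f w / (q m w * (w - z)))) \<le> L p * (M / (\<rho> ^ m * \<rho>))"
        proof (rule L(2))
          show "continuous_on (path_image (g p)) (\<lambda>w. f w / (q m w * (w - z)))"
            using holomorphic_on_imp_continuous_on[OF rhol] sub[OF p] by (rule continuous_on_subset)
          show "0 \<le> M / (\<rho> ^ m * \<rho>)" using M(2) \<rho> by simp
          fix w assume "w \<in> path_image (g p)"
          then have w: "w \<in> \<Gamma>" using p by (auto simp: \<Gamma>_def)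
          have "(\<Prod>i<m. \<rho>) \<le> (\<Prod>i<m. cmod (w - a i))"
            using \<rho> w a by (intro prod_mono) (auto simp: less_imp_le)
          then have "\<rho> ^ m \<le> cmod (q m w)" by (simp add: q_def prod_norm)
          then have "\<rho> ^ m * \<rho> \<le> cmod (q m w) * cmod (w - z)"
            using \<rho> w z by (intro mult_mono) auto
          then show "cmod (f w / (q m w * (w - z))) \<le> M / (\<rho> ^ m * \<rho>)"
            unfolding norm_divide norm_mult using M(1)[OF w] \<rho> M(2) by (intro frac_le) auto
        qed
      qed
      also have "\<dots> = (\<Sum>p\<in>B. L p) * (M / (\<rho> ^ m * \<rho>))"
        by (rule sum_distrib_right[symmetric])
      also have "\<dots> = (C - 1) * M / \<rho> ^ m"
        by (simp add: C_def mult_ac)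
      also have "\<dots> \<le> C * M / \<rho> ^ m"
        using M(2) \<rho> by (intro divide_right_mono mult_right_mono) auto
      finally have "2 * pi * cmod (f z - poly Q z) \<le> cmod (q m z) * (C * M / \<rho> ^ m)"
        unfolding 1 by (intro mult_left_mono) auto
      moreover have "1 * cmod (f z - poly Q z) \<le> 2 * pi * cmod (f z - poly Q z)"
        using pi_ge_two by (intro mult_right_mono) auto
      ultimately show ?thesis
        by (simp add: norm_minus_commute q_def prod_norm mult_ac)
    qed
    ultimately show ?thesis by blast
  qed
  show thesis
    by (rule that[OF \<Gamma>(1,2) \<open>C > 0\<close> \<rho>(1) main])
qed

subsection \<open>Approximation by lacunary polynomials\<close>

lemma
  assumes "compact X" "continuous_on X f"
  shows sup_norm_nonneg: "0 \<le> sup_norm X f"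
    and norm_le_sup_norm: "\<And>x. x \<in> X \<Longrightarrow> cmod (f x) \<le> sup_norm X f"
proof -
  have "bounded ((\<lambda>x. cmod (f x)) ` X)"
    using assms by (intro compact_imp_bounded compact_continuous_image continuous_intros)
  then have bdd: "bdd_above ((\<lambda>x. cmod (f x)) ` X)"
    by (rule bounded_imp_bdd_above)
  show le: "cmod (f x) \<le> sup_norm X f" if "x \<in> X" for x
    using that cSUP_upper[OF that bdd] by (auto simp: sup_norm_def)
  show "0 \<le> sup_norm X f"
  proof (cases "X = {}")
    case False
    then obtain x where "x \<in> X" by blast
    then show ?thesis using le[of x] norm_ge_zero[of "f x"] by linarith
  qed (simp add: sup_norm_def)
qed

lemma sup_norm_le:
  assumes "0 \<le> c" "\<And>x. x \<in> X \<Longrightarrow> cmod (f x) \<le> c"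
  shows "sup_norm X f \<le> c"
  using assms by (auto simp: sup_norm_def intro!: cSUP_least)

lemma poly_as_sum_of_monoms_between:
  assumes "\<And>k. k < l \<Longrightarrow> coeff P k = 0" "\<And>k. n < k \<Longrightarrow> coeff P k = 0"
  shows "P = (\<Sum>k=l..n. monom (coeff P k) k)"
proof (rule poly_eqI)
  fix j
  have "coeff (\<Sum>k=l..n. monom (coeff P k) k) j = (\<Sum>k=l..n. if k = j then coeff P k else 0)"
    by (simp add: coeff_sum)
  also have "\<dots> = (if j \<in> {l..n} then coeff P j else 0)"
    by (subst sum.delta) auto
  also have "\<dots> = coeff P j" using assms[of j] by (auto simp: not_le)
  finally show "coeff P j = coeff (\<Sum>k=l..n. monom (coeff P k) k) j" ..
qed

text \<open>Interpolation uses the d roots cyclically, k times each; the node polynomial is then the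
  k-th power of the small one.\<close>

lemma prod_periodic:
  fixes g :: "nat \<Rightarrow> 'a::comm_monoid_mult"
  shows "(\<Prod>i<d * k. g (i mod d)) = (\<Prod>i<d. g i) ^ k"
proof -
  have "(\<Prod>i<k * d. g (i mod d)) = (\<Prod>j<k. \<Prod>i\<in>{j * d..<j * d + d}. g (i mod d))"
    by (rule prod.nat_group[symmetric])
  also have "\<dots> = (\<Prod>j<k. \<Prod>i<d. g i)"
  proof (rule prod.cong[OF refl])
    fix j
    have "(\<Prod>i\<in>{j * d..<j * d + d}. g (i mod d)) = (\<Prod>i\<in>{0..<d}. g ((i + j * d) mod d))"
      using prod.shift_bounds_nat_ivl[of "\<lambda>i. g (i mod d)" 0 "j * d" d] by (simp add: add.commute)
    then show "(\<Prod>i\<in>{j * d..<j * d + d}. g (i mod d)) = (\<Prod>i<d. g i)"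
      by (simp add: lessThan_atLeast0)
  qed
  finally show ?thesis by (simp add: mult.commute)
qed

text \<open>\<open>r n\<close> is the largest index j whose threshold has been passed by n; the
  restriction j \<le> n keeps the set finite. Before \<open>N 0\<close> the set may be empty and
  \<open>Max\<close> unspecified.\<close>

lemma eventually_diagonal:
  fixes P :: "nat \<Rightarrow> nat \<Rightarrow> bool"
  assumes "\<And>j. \<forall>\<^sub>F n in sequentially. P j n"
  obtains r where "filterlim r at_top sequentially" "\<forall>\<^sub>F n in sequentially. P (r n) n"
proof -
  have "\<forall>j. \<exists>N. \<forall>n\<ge>N. P j n" using assms by (simp add: eventually_sequentially)
  then obtain N where N: "\<And>j n. n \<ge> N j \<Longrightarrow> P j n" by metis
  define r where "r n = Max {j. j \<le> n \<and> N j \<le> n}" for n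
  have fin: "finite {j. j \<le> n \<and> N j \<le> n}" for n by simp
  have "\<forall>\<^sub>F n in sequentially. P (r n) n"
    using eventually_ge_at_top[of "N 0"]
  proof eventually_elim
    case (elim n)
    then have "{j. j \<le> n \<and> N j \<le> n} \<noteq> {}" by auto
    from Max_in[OF fin this] show ?case by (intro N) (simp add: r_def)
  qed
  moreover have "filterlim r at_top sequentially"
    unfolding filterlim_at_top
  proof
    fix Z
    show "\<forall>\<^sub>F n in sequentially. Z \<le> r n"
      using eventually_ge_at_top[of "max Z (N Z)"]
    proof eventually_elim
      case (elim n)
      then show ?case unfolding r_def by (intro Max_ge fin) auto
    qed
  qed
  ultimately show thesis using that by blast
qed

lemma lacunary_approximation:
  fixes K U :: "complex set"
  assumes K: "compact K" "0 \<notin> K" "polar K" "K \<noteq> {}"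
    and U: "open U" "bounded U" "K \<subseteq> U" and \<epsilon>: "\<epsilon> > 0"
  shows "\<forall>\<^sub>F n in sequentially. \<forall>\<phi> \<in> A_space (closure U).
      \<exists>P :: complex poly.
        (\<exists>a :: nat \<Rightarrow> complex. P = (\<Sum>k = nat \<lfloor>real n / (1 + \<epsilon>)\<rfloor>..n. monom (a k) k)) \<and>
        sup_norm K (\<lambda>z. poly P z - \<phi> z) \<le> sup_norm (closure U) \<phi> * \<epsilon> ^ n"
proof -
  define W where "W = U - {0}"
  have W: "open W" "K \<subseteq> W" using U K(2) by (auto simp: W_def)
  obtain \<Gamma> :: "complex set" and C \<rho> :: real where \<Gamma>: "compact \<Gamma>" "\<Gamma> \<subseteq> W" and C: "C > 0" and \<rho>: "\<rho> > 0"
    and interp: "\<And>f M a m. f holomorphic_on W \<Longrightarrow> (\<And>w. w \<in> \<Gamma> \<Longrightarrow> cmod (f w) \<le> M) \<Longrightarrow> 0 \<le> M \<Longrightarrow>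
      (\<And>i :: nat. i < m \<Longrightarrow> a i \<in> K) \<Longrightarrow>
      \<exists>Q. (\<forall>k\<ge>m. coeff Q k = 0) \<and>
        (\<forall>z\<in>K. cmod (poly Q z - f z) \<le> C * M * (\<Prod>i<m. cmod (z - a i)) / \<rho> ^ m)"
    by (rule polynomial_interpolation_bound[OF K(1,3) W]) blast
  obtain \<delta> where \<delta>: "0 < \<delta>" "\<And>w. w \<in> \<Gamma> \<Longrightarrow> \<delta> \<le> cmod w"
  proof -
    have "{0} \<inter> \<Gamma> = {}" using \<Gamma>(2) by (auto simp: W_def)
    then show thesis
      using separate_compact_closed[of "{0}" \<Gamma>] \<Gamma>(1) that by (auto simp: compact_imp_closed)
  qed
  obtain R where R: "R > 0" "\<And>z. z \<in> K \<Longrightarrow> cmod z \<le> R"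
    using compact_imp_bounded[OF K(1)] by (auto simp: bounded_pos)
  \<comment> \<open>Being at least 1, A allows the loss (R / \<open>\<delta>\<close>)^s to be
    bounded by A^n for every s \<le> n.\<close>
  define A where "A = max 1 (R / \<delta>)"
  have A: "1 \<le> A" "R \<le> A * \<delta>"
    using \<delta>(1) by (auto simp: A_def max_def field_simps)
  define \<sigma> where "\<sigma> = \<epsilon> / (1 + \<epsilon>)"
  have \<sigma>: "0 < \<sigma>" "\<sigma> < 1" using \<epsilon> by (auto simp: \<sigma>_def)
  \<comment> \<open>The product A * b stays below half of \<open>\<epsilon>\<close>; the spare
    factor 2^n absorbs the constant C.\<close>
  define b where "b = min \<epsilon> 1 / (2 * A)"
  have b: "0 < b" "b \<le> 1" "A * b \<le> \<epsilon> / 2"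
    using A \<epsilon> by (auto simp: b_def field_simps)
  \<comment> \<open>t bounds n / m: for large n the number m of nodes is at least half of
    \<open>\<sigma> * n\<close>.\<close>
  obtain t :: nat where t: "2 / \<sigma> \<le> t" using real_arch_simple by blast
  \<comment> \<open>Then (\<open>\<kappa>\<close> / \<open>\<rho>\<close>)^m \<le> b^(t m) \<le>
    b^n.\<close>
  define \<kappa> where "\<kappa> = min (1 / 2) (\<rho> * b ^ t)"
  have \<kappa>: "0 < \<kappa>" "\<kappa> < 1" "\<kappa> \<le> \<rho> * b ^ t" using \<rho> b by (auto simp: \<kappa>_def)
  obtain d and a :: "nat \<Rightarrow> complex" where d: "d > 0" "\<And>i. i < d \<Longrightarrow> a i \<in> K"
    "\<And>z. z \<in> K \<Longrightarrow> (\<Prod>i<d. cmod (z - a i)) < \<kappa> ^ d"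
    using polar_small_product[OF K(1,3,4) \<kappa>(1,2)] by blast
  have "\<forall>\<^sub>F n in sequentially. C \<le> 2 ^ n"
  proof -
    obtain n0 where "C < 2 ^ n0" using real_arch_pow[of 2 C] by auto
    have "C \<le> 2 ^ n" if "n \<ge> n0" for n
      using power_increasing[OF that, of "2 :: real"] \<open>C < 2 ^ n0\<close> by linarith
    then show ?thesis
      by (rule eventually_sequentiallyI)
  qed
  moreover have "\<forall>\<^sub>F n in sequentially. 2 * d / \<sigma> \<le> real n"
    by (rule eventually_sequentiallyI[of "nat \<lceil>2 * d / \<sigma>\<rceil>"]) linarith
  ultimately show ?thesis
  proof eventually_elim
    case (elim n)
    show ?case
    proof
      fix \<phi> assume "\<phi> \<in> A_space (closure U)"
      then have \<phi>: "continuous_on (closure U) \<phi>" "\<phi> holomorphic_on interior (closure U)"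
        by (auto simp: A_space_def)
      define N where "N = sup_norm (closure U) \<phi>"
      have N: "0 \<le> N" "\<And>w. w \<in> closure U \<Longrightarrow> cmod (\<phi> w) \<le> N"
        unfolding N_def using sup_norm_nonneg[OF _ \<phi>(1)] norm_le_sup_norm[OF _ \<phi>(1)] U(2) by (auto simp: compact_closure)
      have \<phi>U: "\<phi> holomorphic_on U"
        using \<phi>(2) by (rule holomorphic_on_subset) (simp add: U(1) closure_subset interior_maximal)
      \<comment> \<open>m is the largest multiple of d not exceeding \<open>\<sigma> * n\<close>, so
        whole powers of the small polynomial can be used.\<close>
      define k where "k = nat \<lfloor>\<sigma> * n / d\<rfloor>"
      define m where "m = d * k"
      have "real k \<le> \<sigma> * n / d" "\<sigma> * n / d < real k + 1"
        using \<sigma> by (auto simp: k_def)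
      then have m: "real m \<le> \<sigma> * n" "\<sigma> * n < m + d"
        using d(1) by (auto simp: m_def field_simps)
      have "\<sigma> * n \<le> n" using \<sigma> by (intro mult_left_le_one_le) auto
      then have "m \<le> n" using m by linarith
      define s where "s = n - m"
      have s: "n = s + m" using \<open>m \<le> n\<close> by (simp add: s_def)
      have "2 * d \<le> \<sigma> * n" using elim(2) \<sigma> by (simp add: field_simps)
      then have "\<sigma> * n \<le> 2 * m" using m by linarith
      then have "n \<le> (2 / \<sigma>) * m" using \<sigma> by (simp add: field_simps)
      also have "\<dots> \<le> t * m" unfolding of_nat_mult using t by (intro mult_right_mono) auto
      finally have tm: "n \<le> t * m" by (simp flip: of_nat_mult)
      have lo: "nat \<lfloor>real n / (1 + \<epsilon>)\<rfloor> \<le> s"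
      proof -
        have "real n / (1 + \<epsilon>) = n - \<sigma> * n" using \<epsilon> by (simp add: \<sigma>_def field_simps)
        also have "\<dots> \<le> s" using m s by simp
        finally show ?thesis by linarith
      qed
      have fhol: "(\<lambda>w. \<phi> w / w ^ s) holomorphic_on W"
        by (intro holomorphic_intros holomorphic_on_subset[OF \<phi>U]) (auto simp: W_def)
      have fbd: "cmod (\<phi> w / w ^ s) \<le> N / \<delta> ^ s" if "w \<in> \<Gamma>" for w
        unfolding norm_divide norm_power
      proof (rule frac_le)
        have "w \<in> closure U" using \<Gamma>(2) that closure_subset by (auto simp: W_def)
        then show "cmod (\<phi> w) \<le> N" by (rule N)
        show "\<delta> ^ s \<le> cmod w ^ s" using \<delta> that by (intro power_mono) auto
      qed (use N \<delta> in auto)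
      have "\<exists>Q. (\<forall>k\<ge>m. coeff Q k = 0) \<and> (\<forall>z\<in>K. cmod (poly Q z - \<phi> z / z ^ s) \<le>
           C * (N / \<delta> ^ s) * (\<Prod>i<m. cmod (z - a (i mod d))) / \<rho> ^ m)"
        by (rule interp[OF fhol fbd]) (use N(1) \<delta>(1) d(1,2) in auto)
      then obtain Q where Q: "\<And>k. m \<le> k \<Longrightarrow> coeff Q k = 0"
        "\<And>z. z \<in> K \<Longrightarrow> cmod (poly Q z - \<phi> z / z ^ s) \<le>
           C * (N / \<delta> ^ s) * (\<Prod>i<m. cmod (z - a (i mod d))) / \<rho> ^ m"
        by blast
      \<comment> \<open>Q has degree below m, so the exponents of P lie between s and s + m - 1 = n
        - 1.\<close>
      define P where "P = monom 1 s * Q"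
      have "P = (\<Sum>k=nat \<lfloor>real n / (1 + \<epsilon>)\<rfloor>..n. monom (coeff P k) k)"
        by (rule poly_as_sum_of_monoms_between) (use lo s Q(1) in \<open>auto simp: P_def coeff_monom_mult\<close>)
      moreover have "sup_norm K (\<lambda>z. poly P z - \<phi> z) \<le> N * \<epsilon> ^ n"
      proof (rule sup_norm_le)
        fix z assume z: "z \<in> K"
        have "z \<noteq> 0" using z K(2) by auto
        have "(\<Prod>i<m. cmod (z - a (i mod d))) = (\<Prod>i<d. cmod (z - a i)) ^ k"
          unfolding m_def by (rule prod_periodic)
        also have "\<dots> \<le> (\<kappa> ^ d) ^ k"
          using d(3)[OF z] by (intro power_mono prod_nonneg) auto
        also have "\<dots> = \<kappa> ^ m" by (simp add: m_def power_mult)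
        also have "\<dots> \<le> (\<rho> * b ^ t) ^ m" using \<kappa> by (intro power_mono) auto
        also have "\<dots> = \<rho> ^ m * b ^ (t * m)" by (simp add: power_mult_distrib power_mult)
        also have "\<dots> \<le> \<rho> ^ m * b ^ n"
          using \<rho> b tm by (intro mult_left_mono power_decreasing) auto
        finally have pb: "(\<Prod>i<m. cmod (z - a (i mod d))) \<le> \<rho> ^ m * b ^ n" .
        have "R ^ s \<le> (A * \<delta>) ^ s" using A R by (intro power_mono) auto
        then have Rs: "R ^ s / \<delta> ^ s \<le> A ^ s"
          using \<delta> by (simp add: power_mult_distrib field_simps)
        have "poly P z - \<phi> z = z ^ s * (poly Q z - \<phi> z / z ^ s)"
          using \<open>z \<noteq> 0\<close> by (simp add: P_def poly_monom algebra_simps)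
        then have "cmod (poly P z - \<phi> z) = cmod z ^ s * cmod (poly Q z - \<phi> z / z ^ s)"
          by (simp add: norm_mult norm_power)
        also have "\<dots> \<le> R ^ s * (C * (N / \<delta> ^ s) * (\<Prod>i<m. cmod (z - a (i mod d))) / \<rho> ^ m)"
          using R z by (intro mult_mono Q(2) power_mono) auto
        also have "\<dots> \<le> R ^ s * (C * (N / \<delta> ^ s) * (\<rho> ^ m * b ^ n) / \<rho> ^ m)"
          using R \<rho> \<delta> C N pb by (intro mult_left_mono divide_right_mono) auto
        also have "\<dots> = C * N * b ^ n * (R ^ s / \<delta> ^ s)"
          using \<rho> by simp
        also have "\<dots> \<le> C * N * b ^ n * A ^ s"
          using C N b by (intro mult_left_mono Rs) auto
        also have "\<dots> \<le> C * N * b ^ n * A ^ n"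
          using C N b A s by (intro mult_left_mono power_increasing) auto
        also have "\<dots> = N * (C * (A * b) ^ n)"
          by (simp add: power_mult_distrib)
        also have "\<dots> \<le> N * (2 ^ n * (\<epsilon> / 2) ^ n)"
          using N b A C elim(1) by (intro mult_left_mono mult_mono power_mono) auto
        also have "\<dots> = N * \<epsilon> ^ n"
          by (simp flip: power_mult_distrib)
        finally show "cmod (poly P z - \<phi> z) \<le> N * \<epsilon> ^ n" .
      qed (use N \<epsilon> in auto)
      ultimately show "\<exists>P :: complex poly.
        (\<exists>a :: nat \<Rightarrow> complex. P = (\<Sum>k = nat \<lfloor>real n / (1 + \<epsilon>)\<rfloor>..n. monom (a k) k)) \<and>
        sup_norm K (\<lambda>z. poly P z - \<phi> z) \<le> sup_norm (closure U) \<phi> * \<epsilon> ^ n"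
        unfolding N_def by blast
    qed
  qed
qed

theorem theoremE:
  fixes K U :: "complex set"
  assumes "compact K" and "0 \<notin> K" and "polar K"
    and "open U" and "bounded U" and "K \<subseteq> U"
  shows "\<exists>(\<tau> :: nat \<Rightarrow> real) (\<eta> :: nat \<Rightarrow> real) (N :: nat).
    (\<forall>n. 1 < \<tau> n) \<and> \<tau> \<longlonglongrightarrow> 1 \<and> (\<forall>n. 0 < \<eta> n) \<and> \<eta> \<longlonglongrightarrow> 0 \<and>
    (\<forall>\<phi> \<in> A_space (closure U). \<forall>n\<ge>N.
      \<exists>P :: complex poly.
        (\<exists>a :: nat \<Rightarrow> complex. P = (\<Sum>k = nat \<lfloor>real n / \<tau> n\<rfloor>..n. monom (a k) k)) \<and>
        sup_norm K (\<lambda>z. poly P z - \<phi> z) \<le> sup_norm (closure U) \<phi> * \<eta> n ^ n)"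
proof -
  define G where "G \<epsilon> n \<longleftrightarrow> (\<forall>\<phi> \<in> A_space (closure U). \<exists>P :: complex poly.
        (\<exists>a :: nat \<Rightarrow> complex. P = (\<Sum>k = nat \<lfloor>real n / (1 + \<epsilon>)\<rfloor>..n. monom (a k) k)) \<and>
        sup_norm K (\<lambda>z. poly P z - \<phi> z) \<le> sup_norm (closure U) \<phi> * \<epsilon> ^ n)" for \<epsilon> n
  define \<epsilon> where "\<epsilon> j = inverse (real (Suc j))" for j
  have \<epsilon>: "\<epsilon> j > 0" for j by (simp add: \<epsilon>_def)
  have "\<forall>\<^sub>F n in sequentially. G (\<epsilon> j) n" for j
  \<comment> \<open>For empty K there are no points to serve as roots, but the norm on K is 0 and
    any polynomial of the required form works.\<close>
  proof (cases "K = {}")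
    case True
    have "G (\<epsilon> j) n" for n
      unfolding G_def
    proof
      fix \<phi> assume "\<phi> \<in> A_space (closure U)"
      then have "0 \<le> sup_norm (closure U) \<phi>"
        using assms(5) by (intro sup_norm_nonneg) (auto simp: A_space_def compact_closure)
      then show "\<exists>P :: complex poly.
        (\<exists>a :: nat \<Rightarrow> complex. P = (\<Sum>k = nat \<lfloor>real n / (1 + \<epsilon> j)\<rfloor>..n. monom (a k) k)) \<and>
        sup_norm K (\<lambda>z. poly P z - \<phi> z) \<le> sup_norm (closure U) \<phi> * \<epsilon> j ^ n"
        using True \<epsilon>[of j] by (auto simp: sup_norm_def)
    qed
    then show ?thesis by simp
  next
    case False
    then show ?thesis
      unfolding G_def using lacunary_approximation[OF assms(1-3) False assms(4-6) \<epsilon>] by blast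
  qed
  then obtain r where r: "filterlim r at_top sequentially" "\<forall>\<^sub>F n in sequentially. G (\<epsilon> (r n)) n"
    using eventually_diagonal[of "\<lambda>j. G (\<epsilon> j)"] by blast
  from r(2) obtain N where N: "\<And>n. n \<ge> N \<Longrightarrow> G (\<epsilon> (r n)) n"
    by (auto simp: eventually_sequentially)
  have "\<epsilon> \<longlonglongrightarrow> 0"
    unfolding \<epsilon>_def by (rule LIMSEQ_inverse_real_of_nat)
  then have lim: "(\<lambda>n. \<epsilon> (r n)) \<longlonglongrightarrow> 0"
    using r(1) by (rule filterlim_compose)
  then have "(\<lambda>n. 1 + \<epsilon> (r n)) \<longlonglongrightarrow> 1 + 0"
    by (intro tendsto_intros)
  then show ?thesis
    using \<epsilon> lim N unfolding G_def
    by (intro exI[of _ "\<lambda>n. 1 + \<epsilon> (r n)"] exI[of _ "\<lambda>n. \<epsilon> (r n)"] exI[of _ N]) auto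
qed

end
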